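(* Let $p$ be an odd prime and let $L=\theta^4+a_3(t)\theta^3+a_2(t)\theta^2+a_1(t)\theta+a_0(t)$ with $a_i(t)\in\mathbb{Z}_p[[t]]$, $a_i(0)=0$ for $i=0,\ldots,3$, $\theta=t\frac{d}{dt}$. Let $y_0,y_1,y_2,y_3$ be the standard basis of solutions of $L(y)=0$, with associated power series $F_0,\ldots,F_3$, and suppose $\exp(F_1/F_0)\in\mathbb{Z}_p[[t]]$. Put $q=t\exp(F_1/F_0)$ and let $\sigma$ be the Frobenius lift determined by $q^\sigma=q^p$. Let $K(q)=\theta_q^2(y_2/y_0)$, where $\theta_q=q\frac{d}{dq}$, and define $A_r$ ($r\ge1$) by $$K(q)=1+\sum_{r\ge1}\frac{A_rq^r}{1-q^r}.$$ Suppose that $L$ is self-dual and that $L(y)=0$ has a $p$-adic Frobenius structure with $\alpha_1=0$. Then $A_r/r^3\in\mathbb{Z}_p$ for all $r\ge1$.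
   Context: Standard basis: since all $a_i(0)=0$ (MUM-type), $L(y)=0$ has a unique basis of solutions in $\mathbb{Q}_p[[t]][\log t]$ of the form $$y_i=F_0\frac{\log^i t}{i!}+F_1\frac{\log^{i-1}t}{(i-1)!}+\cdots+F_{i-1}\log t+F_i,\qquad i=0,1,2,3,$$ with $F_i\in\mathbb{Q}_p[[t]]$, $F_0(0)=1$ and $F_i(0)=0$ for $i>0$. Solutions of $L(y)=0$ are the $\mathbb{Q}_p$-linear combinations of the $y_i$. Self-duality: $L$ is self-dual if $$a_1=\tfrac12a_2a_3-\tfrac18a_3^3+\theta(a_2)-\tfrac34a_3\theta(a_3)-\tfrac12\theta^2(a_3).$$ (In that case $y_0\,\theta y_3-y_3\,\theta y_0=y_1\,\theta y_2-y_2\,\theta y_1$.) Canonical coordinate: $q=t\exp(F_1/F_0)\in t+t^2\mathbb{Z}_p[[t]]$, so $\mathbb{Z}_p[[q]]=\mathbb{Z}_p[[t]]$ and $t$ is a power series in $q$. In terms of $q$ one has $y_1/y_0=\log q$ and $y_2/y_0=\frac12\log^2q+V(q)$ with $V=F_2/F_0-\frac12(F_1/F_0)^2\in q\mathbb{Q}_p[[q]]$, so $K(q)=1+\theta_q^2V$. Frobenius lift: $\sigma$ is the ring endomorphism of $\mathbb{Z}_p[[t]]=\mathbb{Z}_p[[q]]$ given by $h(q)\mapsto h(q^p)$ (the "excellent lift"). It has the form $t^\sigma=t^p(1+p\,t\,u(t))$ with $u\in\mathbb{Z}_p[[t]]$. It is extended to solutions by $F_i^\sigma=F_i(t^\sigma)$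 and $\log t^\sigma=p\log t-\sum_{m\ge1}\frac1m(-p\,t\,u(t))^m$; equivalently $\log q\mapsto p\log q$. One writes $y(t^\sigma)=y^\sigma$. Frobenius structure: $L(y)=0$ has a $p$-adic Frobenius structure (with respect to $\sigma$) if there is an operator $\mathcal{A}=\sum_{i=0}^{3}A_i(t)\theta^i\in\mathbb{Z}_p[[t]][\theta]$ with $A_0(0)=1$ such that for every solution $y(t)$ of $L(y)=0$ the composition $\mathcal{A}(y(t^\sigma))$ is again a solution of $L(y)=0$. The Frobenius constants are $\alpha_i=A_i(0)$. *)

theory Defs
  imports
    "Berlekamp_Zassenhaus.Finite_Field"
    "HOL-Computational_Algebra.Formal_Power_Series"
    "HOL-Computational_Algebra.Fraction_Field"
begin

section \<open>The \<open>p\<close>-adic integers and the \<open>p\<close>-adic numbers\<close>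

text \<open>
  The prime is \<open>p = CARD('p)\<close> for a type \<open>'p\<close> of class \<^class>\<open>prime_card\<close>; every prime is the
  cardinality of such a type. The ring of \<open>p\<close>-adic integers is the inverse limit of the rings
  of integers modulo \<open>p ^ n\<close>, each residue class being given by its representative
  in \<open>{0..<p ^ n}\<close>.
\<close>

typedef 'p padic_int =
  "{x :: nat \<Rightarrow> int. \<forall>n. x (Suc n) mod int CARD('p) ^ n = x n}"
  by (rule exI[of _ "\<lambda>_. 0"]) simp

setup_lifting type_definition_padic_int

lemma padic_compat_mod:
  fixes q :: int
  assumes "\<forall>n. x (Suc n) mod q ^ n = x n"
  shows "x (n + k) mod q ^ n = x n"
proof (induction k)
  case 0
  have "x (Suc n) mod q ^ n = x n" using assms by blast
  then show ?case by (metis add_0_right mod_mod_trivial)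
next
  case (Suc k)
  have "x (n + Suc k) mod q ^ n = x (Suc (n + k)) mod q ^ (n + k) mod q ^ n"
    by (simp add: mod_mod_cancel le_imp_power_dvd)
  also have "\<dots> = x (n + k) mod q ^ n" using assms by simp
  finally show ?case using Suc by simp
qed

lemma padic_mod_self:
  fixes q :: int
  assumes "\<forall>n. x (Suc n) mod q ^ n = x n"
  shows "x n mod q ^ n = x n"
  using padic_compat_mod[OF assms, of n 0] by simp

lemma padic_reduce:
  fixes q :: int
  shows "(z mod q ^ Suc n) mod q ^ n = z mod q ^ n"
  by (rule mod_mod_cancel) (simp add: le_imp_power_dvd)

instantiation padic_int :: (prime_card) comm_ring_1
begin

lift_definition zero_padic_int :: "'a padic_int" is "\<lambda>_. 0" by simp

lift_definition one_padic_int :: "'a padic_int" is "\<lambda>n. 1 mod int CARD('a) ^ n"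
  by (simp only: padic_reduce simp_thms)

lift_definition plus_padic_int :: "'a padic_int \<Rightarrow> 'a padic_int \<Rightarrow> 'a padic_int"
  is "\<lambda>x y n. (x n + y n) mod int CARD('a) ^ n"
  by (simp only: padic_reduce) (metis mod_add_eq)

lift_definition minus_padic_int :: "'a padic_int \<Rightarrow> 'a padic_int \<Rightarrow> 'a padic_int"
  is "\<lambda>x y n. (x n - y n) mod int CARD('a) ^ n"
  by (simp only: padic_reduce) (metis mod_diff_eq)

lift_definition uminus_padic_int :: "'a padic_int \<Rightarrow> 'a padic_int"
  is "\<lambda>x n. (- x n) mod int CARD('a) ^ n"
  by (simp only: padic_reduce) (metis mod_minus_eq)

lift_definition times_padic_int :: "'a padic_int \<Rightarrow> 'a padic_int \<Rightarrow> 'a padic_int"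
  is "\<lambda>x y n. (x n * y n) mod int CARD('a) ^ n"
  by (simp only: padic_reduce) (metis mod_mult_eq)

instance
proof
  fix a b c :: "'a padic_int"
  have p1: "int CARD('a) > 1" using prime_card_int[where 'a='a] by (rule prime_gt_1_int)
  show "a * b * c = a * (b * c)"
    by transfer (simp add: mod_simps mult.assoc)
  show "a * b = b * a"
    by transfer (simp add: mult.commute)
  show "1 * a = a"
    by transfer (simp add: mod_simps padic_mod_self)
  show "a + b + c = a + (b + c)"
    by transfer (simp add: mod_simps add.assoc)
  show "a + b = b + a"
    by transfer (simp add: add.commute)
  show "0 + a = a"
    by transfer (simp add: padic_mod_self)
  show "- a + a = 0"
    by transfer (simp add: mod_simps)
  show "a - b = a + - b"
    by transfer (simp add: mod_simps)
  show "(a + b) * c = a * c + b * c"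
    by transfer (simp add: mod_simps distrib_right)
  show "(0 :: 'a padic_int) \<noteq> 1"
  proof (transfer, rule notI)
    assume "(\<lambda>_. 0) = (\<lambda>n. 1 mod int CARD('a) ^ n)"
    then have "0 = 1 mod int CARD('a) ^ 1" by (rule fun_cong)
    with p1 show False by simp
  qed
qed

end

instance padic_int :: (prime_card) idom
proof
  fix a b :: "'a padic_int"
  assume "a \<noteq> 0" "b \<noteq> 0"
  then show "a * b \<noteq> 0"
  proof transfer
    fix a b :: "nat \<Rightarrow> int"
    let ?p = "int CARD('a)"
    assume a: "\<forall>n. a (Suc n) mod ?p ^ n = a n" and b: "\<forall>n. b (Suc n) mod ?p ^ n = b n"
    assume "a \<noteq> (\<lambda>_. 0)" "b \<noteq> (\<lambda>_. 0)"
    then obtain m n where mn: "a m \<noteq> 0" "b n \<noteq> 0" by (auto simp: fun_eq_iff)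
    let ?x = "a (m + n)" and ?y = "b (m + n)"
    have p: "prime ?p" by (rule prime_card_int)
    have x: "\<not> ?p ^ m dvd ?x"
      using padic_compat_mod[OF a, of m n] mn by (simp add: dvd_eq_mod_eq_0)
    have y: "\<not> ?p ^ n dvd ?y"
      using padic_compat_mod[OF b, of n m] mn by (simp add: dvd_eq_mod_eq_0 add.commute)
    have nz: "?x \<noteq> 0" "?y \<noteq> 0" using x y by auto
    have lt: "multiplicity ?p ?x < m" "multiplicity ?p ?y < n"
      using x y multiplicity_dvd' not_le by blast+
    have "multiplicity ?p (?x * ?y) = multiplicity ?p ?x + multiplicity ?p ?y"
      using p nz by (intro prime_elem_multiplicity_mult_distrib) auto
    then have "multiplicity ?p (?x * ?y) < m + n" using lt by simp
    moreover have "\<not> is_unit ?p" using p not_prime_unit by blast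
    moreover have "?x * ?y \<noteq> 0" using nz by simp
    ultimately have "\<not> ?p ^ (m + n) dvd ?x * ?y"
      by (meson multiplicity_geI not_le)
    then have "(?x * ?y) mod ?p ^ (m + n) \<noteq> 0" by (simp add: dvd_eq_mod_eq_0)
    then show "(\<lambda>n. a n * b n mod ?p ^ n) \<noteq> (\<lambda>_. 0)"
      by (rule contrapos_nn) (erule fun_cong)
  qed
qed

lemma of_nat_padic_int:
  "Rep_padic_int (of_nat k :: 'p::prime_card padic_int) n = int k mod int CARD('p) ^ n"
proof (induction k)
  case 0
  show ?case by (simp add: zero_padic_int.rep_eq)
next
  case (Suc k)
  then show ?case by (simp add: plus_padic_int.rep_eq one_padic_int.rep_eq mod_simps)
qed

instance padic_int :: (prime_card) ring_char_0
proof (standard, rule injI)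
  fix k l :: nat
  let ?p = "int CARD('a)"
  assume eq: "(of_nat k :: 'a padic_int) = of_nat l"
  let ?n = "k + l"
  have "?p \<ge> 2" using prime_card_int[where 'a='a] by (rule prime_ge_2_int)
  then have "int 2 ^ ?n \<le> ?p ^ ?n" by (intro power_mono) auto
  moreover have "int ?n < int 2 ^ ?n" by (metis less_exp of_nat_less_iff of_nat_power)
  ultimately have "int k < ?p ^ ?n" "int l < ?p ^ ?n" by linarith+
  moreover have "int k mod ?p ^ ?n = int l mod ?p ^ ?n"
    using eq of_nat_padic_int[of k ?n, where 'p='a] of_nat_padic_int[of l ?n, where 'p='a] by simp
  ultimately show "k = l" by simp
qed

instance fract :: ("{idom,ring_char_0}") field_char_0
proof (standard, rule injI)
  fix k l :: nat
  assume "(of_nat k :: 'a fract) = of_nat l"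
  then show "k = l" by (simp add: of_nat_fract eq_fract)
qed

type_synonym 'p padic = "'p padic_int fract"

definition Zp :: "'p::prime_card padic set" where
  "Zp = range (\<lambda>x. Fraction_Field.Fract x 1)"

definition Zp_fps :: "'p::prime_card padic fps set" where
  "Zp_fps = {f. \<forall>n. fps_nth f n \<in> Zp}"


section \<open>Power series in \<open>t\<close> and polynomials in \<open>log t\<close> over them\<close>

text \<open>
  An element of the ring \<open>k[[t]][log t]\<close> is a polynomial over \<open>k[[t]]\<close>, the polynomial
  variable being \<open>log t\<close>. Since \<open>\<theta> (log t) = 1\<close>, the derivation \<open>\<theta> = t d/dt\<close> of this ring is
  \<open>\<theta>\<close> on the coefficients plus differentiation with respect to \<open>log t\<close>.
\<close>

definition theta :: "'k::field_char_0 fps \<Rightarrow> 'k fps" where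
  "theta f = fps_X * fps_deriv f"

definition theta_log :: "'k::field_char_0 fps poly \<Rightarrow> 'k fps poly" where
  "theta_log y = map_poly theta y + pderiv y"

text \<open>
  For \<open>s = t ^ n * (1 + x)\<close> with \<open>x \<in> t k[[t]]\<close>, the series \<open>log s\<close> is
  \<open>n log t + log (1 + x)\<close>. It is only used for such \<open>s\<close>, with \<open>n \<ge> 1\<close>.
\<close>

definition log_series :: "'k::field_char_0 fps \<Rightarrow> 'k fps poly" where
  "log_series s =
     [: fps_ln 1 oo (fps_shift (subdegree s) s - 1), of_nat (subdegree s) :]"

text \<open>\<open>log_subst s y\<close> is \<open>y(s)\<close>: replace \<open>t\<close> by \<open>s\<close> and \<open>log t\<close> by \<open>log s\<close>.\<close>

definition log_subst :: "'k::field_char_0 fps \<Rightarrow> 'k fps poly \<Rightarrow> 'k fps poly" where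
  "log_subst s y = pcompose (map_poly (\<lambda>f. f oo s) y) (log_series s)"


section \<open>The differential equation\<close>

text \<open>\<open>diff_op a\<close> is \<open>L = \<theta>^4 + a 3 \<theta>^3 + a 2 \<theta>^2 + a 1 \<theta> + a 0\<close>.\<close>

definition diff_op :: "(nat \<Rightarrow> 'k::field_char_0 fps) \<Rightarrow> 'k fps poly \<Rightarrow> 'k fps poly" where
  "diff_op a y = (theta_log ^^ 4) y + (\<Sum>i<4. smult (a i) ((theta_log ^^ i) y))"

definition is_solution :: "(nat \<Rightarrow> 'k::field_char_0 fps) \<Rightarrow> 'k fps poly \<Rightarrow> bool" where
  "is_solution a y \<longleftrightarrow> diff_op a y = 0"

definition std_form :: "(nat \<Rightarrow> 'k::field_char_0 fps) \<Rightarrow> nat \<Rightarrow> 'k fps poly" where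
  "std_form F i = (\<Sum>j\<le>i. monom (fps_const (1 / fact j) * F (i - j)) j)"

text \<open>
  \<open>F 0, \<dots>, F 3\<close> are the series of the standard basis \<open>std_form F 0, \<dots>, std_form F 3\<close>
  of solutions; for \<open>a i (0) = 0\<close> they exist and are determined by these conditions.
\<close>

definition standard_basis ::
  "(nat \<Rightarrow> 'k::field_char_0 fps) \<Rightarrow> (nat \<Rightarrow> 'k fps) \<Rightarrow> bool" where
  "standard_basis a F \<longleftrightarrow>
     fps_nth (F 0) 0 = 1 \<and> (\<forall>i\<in>{1..3}. fps_nth (F i) 0 = 0) \<and>
     (\<forall>i\<le>3. is_solution a (std_form F i))"

definition self_dual :: "(nat \<Rightarrow> 'k::field_char_0 fps) \<Rightarrow> bool" where
  "self_dual a \<longleftrightarrow>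
     a 1 = fps_const (1/2) * a 2 * a 3 - fps_const (1/8) * a 3 ^ 3 + theta (a 2)
           - fps_const (3/4) * a 3 * theta (a 3) - fps_const (1/2) * theta (theta (a 3))"


section \<open>The canonical coordinate and the Frobenius structure\<close>

definition exp_ratio :: "(nat \<Rightarrow> 'k::field_char_0 fps) \<Rightarrow> 'k fps" where
  "exp_ratio F = fps_exp 1 oo (F 1 / F 0)"

definition canonical_coord :: "(nat \<Rightarrow> 'k::field_char_0 fps) \<Rightarrow> 'k fps" where
  "canonical_coord F = fps_X * exp_ratio F"

text \<open>The expansion of \<open>t\<close> as a power series in the canonical coordinate \<open>q\<close>.\<close>

definition t_of_q :: "(nat \<Rightarrow> 'k::field_char_0 fps) \<Rightarrow> 'k fps" where
  "t_of_q F = fps_inv (canonical_coord F)"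

text \<open>
  The image of \<open>t\<close> under the lift \<open>h(q) \<mapsto> h(q ^ p)\<close>, as a power series in \<open>t\<close>. It is of the
  form \<open>t ^ p * (1 + x)\<close>, so that \<open>log_subst (t_sigma F)\<close> is the extension of the lift
  to \<open>k[[t]][log t]\<close>.
\<close>

definition t_sigma :: "(nat \<Rightarrow> 'p::prime_card padic fps) \<Rightarrow> 'p padic fps" where
  "t_sigma F = t_of_q F oo canonical_coord F ^ CARD('p)"

text \<open>
  The operator with coefficients \<open>B 0, \<dots>, B 3\<close> is a \<open>p\<close>-adic Frobenius structure for \<open>L\<close> with
  respect to the lift sending \<open>t\<close> to \<open>s\<close>. The Frobenius constants are \<open>fps_nth (B i) 0\<close>.
\<close>

definition frobenius_structure ::
  "(nat \<Rightarrow> 'p::prime_card padic fps) \<Rightarrow> 'p padic fps \<Rightarrow> (nat \<Rightarrow> 'p padic fps) \<Rightarrow> bool" where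
  "frobenius_structure a s B \<longleftrightarrow>
     (\<forall>i<4. B i \<in> Zp_fps) \<and> fps_nth (B 0) 0 = 1 \<and>
     (\<forall>y. is_solution a y \<longrightarrow>
        is_solution a (\<Sum>i<4. smult (B i) ((theta_log ^^ i) (log_subst s y))))"

text \<open>
  \<open>y_2 / y_0\<close> as an element of \<open>k[[t]][log t]\<close>, where \<open>y_0 = F 0\<close> is a unit of \<open>k[[t]]\<close>,
  and the same element written in \<open>k[[q]][log q]\<close>, where \<open>theta_log\<close> is \<open>\<theta>_q = q d/dq\<close>.
\<close>

definition y2_over_y0 :: "(nat \<Rightarrow> 'k::field_char_0 fps) \<Rightarrow> 'k fps poly" where
  "y2_over_y0 F = smult (inverse (F 0)) (std_form F 2)"

definition y2_over_y0_in_q :: "(nat \<Rightarrow> 'k::field_char_0 fps) \<Rightarrow> 'k fps poly" where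
  "y2_over_y0_in_q F = log_subst (t_of_q F) (y2_over_y0 F)"

end

theory Submission
  imports Defs
begin

text \<open>
  In the coordinate \<open>q\<close>, and after division by \<open>y_0\<close>, the standard basis becomes
  \<open>1\<close>, \<open>log q\<close>, \<open>U = y_2 / y_0\<close>, \<open>W = y_3 / y_0\<close>, and \<open>K = \<theta>_q^2 U\<close>. Self-duality gives the relation
  \<open>y_0 \<theta> y_3 - y_3 \<theta> y_0 = y_1 \<theta> y_2 - y_2 \<theta> y_1\<close> (\<open>self_dual_pairing\<close>), that is,
  \<open>\<theta>_q W = log q * \<theta>_q U - U\<close>. Hence \<open>Z = W - log q * U\<close> satisfies \<open>\<theta>_q Z = - 2 U\<close> and
  \<open>\<theta>_q^3 Z = - 2 K\<close>.

  A solution is determined by its part at \<open>t = 0\<close>, a polynomial in \<open>log t\<close> (\<open>solution_eqI\<close>).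
  Therefore the Frobenius operator sends \<open>y_i(t^\<sigma>)\<close> to \<open>p^i (\<alpha>_0 y_i + \<dots> + \<alpha>_i y_0)\<close>. With
  \<open>\<alpha>_1 = 0\<close>, the images of \<open>y_0\<close> and \<open>y_1\<close> determine the two lowest coefficients of that operator
  conjugated by \<open>y_0\<close>, and eliminating the next one between the images of \<open>y_2\<close> and \<open>y_3\<close> gives
  \<open>Z(q^p) - p^3 Z(q) + p^3 b(q) K(q^p) = const\<close>, where \<open>b\<close> comes from the leading coefficient of
  the operator. Applying \<open>\<theta>_q^3\<close> and dividing by \<open>p^3\<close> one finds
  \<open>2 (K(q) - K(q^p)) = - \<theta>_q^3 (b(q) K(q^p))\<close>
  (\<open>frobenius_relation\<close>).

  The series \<open>F_0\<close> equals the Frobenius operator applied to \<open>F_0(t^\<sigma>)\<close>, and the substitution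
  of \<open>t^\<sigma>\<close> raises \<open>t\<close>-adic orders; so its coefficients are integral by induction, and then so are
  those of \<open>b\<close>. For the same reason the displayed relation makes \<open>K\<close> integral, \<open>p\<close> being odd.
  Comparing coefficients, \<open>k_n - k_{n/p}\<close> is then divisible by \<open>n^3\<close>, where \<open>k_n\<close> is the
  coefficient of \<open>q^n\<close> in \<open>K\<close> and \<open>k_{n/p} = 0\<close> unless \<open>p\<close> divides \<open>n\<close>. As \<open>k_n\<close> is the sum of the
  \<open>A_r\<close> over the divisors of \<open>n\<close>, this is equivalent to divisibility of \<open>A_n\<close> by \<open>n^3\<close>
  (\<open>Zp_div_cube_if_supercongruence\<close>).
\<close>

section \<open>The derivations\<close>

lemma theta_add: "theta (f + g) = theta f + theta g"
  by (simp add: theta_def algebra_simps)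

lemma theta_mult: "theta (f * g) = theta f * g + f * theta g"
  by (simp add: theta_def algebra_simps)

lemma theta_const [simp]: "theta (fps_const c) = 0"
  by (simp add: theta_def)

lemma theta_0 [simp]: "theta 0 = 0" and theta_1 [simp]: "theta 1 = 0"
  by (simp_all add: theta_def)

lemma theta_diff: "theta (f - g) = theta f - theta g"
  by (simp add: theta_def algebra_simps)

lemma fps_nth_theta [simp]: "fps_nth (theta f) n = of_nat n * fps_nth f n"
  by (cases n) (simp_all add: theta_def)

lemma theta_compose:
  assumes "fps_nth s 0 = 0"
  shows "theta (f oo s) = (fps_deriv f oo s) * theta s"
  using assms by (simp add: theta_def fps_compose_deriv)

lemma coeff_theta_log:
  "coeff (theta_log y) j = theta (coeff y j) + of_nat (Suc j) * coeff y (Suc j)"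
  by (simp add: theta_log_def coeff_map_poly coeff_pderiv)

lemma theta_log_0 [simp]: "theta_log 0 = 0"
  by (simp add: theta_log_def)

lemma theta_log_add: "theta_log (y + z) = theta_log y + theta_log z"
  by (intro poly_eqI) (simp add: coeff_theta_log theta_add algebra_simps)

lemma theta_log_diff: "theta_log (y - z) = theta_log y - theta_log z"
  by (intro poly_eqI) (simp add: coeff_theta_log theta_diff algebra_simps)

lemma theta_log_smult: "theta_log (smult f y) = smult (theta f) y + smult f (theta_log y)"
  by (intro poly_eqI) (simp add: coeff_theta_log theta_mult algebra_simps)

lemma theta_log_const [simp]: "theta_log [:f:] = [:theta f:]"
  by (intro poly_eqI) (simp add: coeff_theta_log coeff_pCons split: nat.split)

lemma theta_log_1 [simp]: "theta_log 1 = 0"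
  by (simp add: one_pCons)

lemma theta_log_pCons: "theta_log (pCons f y) = [:theta f:] + y + pCons 0 (theta_log y)"
  by (intro poly_eqI)
     (auto simp add: coeff_theta_log coeff_pCons algebra_simps split: nat.split)

lemma theta_log_mult: "theta_log (y * z) = theta_log y * z + y * theta_log z"
proof (induction y)
  case (pCons f y)
  show ?case
    by (simp add: theta_log_add theta_log_smult theta_log_pCons pCons.IH algebra_simps)
qed simp

text \<open>
  In the coordinate \<open>t\<close> the derivation \<open>q d/dq\<close> is \<open>v \<theta>\<close> for a power series \<open>v\<close>.
\<close>
definition scaled_theta :: "'k::field_char_0 fps \<Rightarrow> 'k fps poly \<Rightarrow> 'k fps poly" where
  "scaled_theta v y = smult v (theta_log y)"

lemma scaled_theta_add: "scaled_theta v (y + z) = scaled_theta v y + scaled_theta v z"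
  by (simp add: scaled_theta_def theta_log_add smult_add_right)

lemma scaled_theta_diff: "scaled_theta v (y - z) = scaled_theta v y - scaled_theta v z"
  by (simp add: scaled_theta_def theta_log_diff smult_diff_right)

lemma scaled_theta_mult: "scaled_theta v (y * z) = scaled_theta v y * z + y * scaled_theta v z"
  by (simp add: scaled_theta_def theta_log_mult smult_add_right)

lemma scaled_theta_const: "scaled_theta v [:f:] = [:v * theta f:]"
  by (simp add: scaled_theta_def)

section \<open>Substitutions in power series with logarithms\<close>

lemma log_subst_0 [simp]: "log_subst s 0 = 0"
  by (simp add: log_subst_def)

lemma log_subst_pCons:
  "log_subst s (pCons f y) = [:f oo s:] + log_series s * log_subst s y"
proof -
  have "map_poly (\<lambda>f. f oo s) (pCons f y) = pCons (f oo s) (map_poly (\<lambda>f. f oo s) y)"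
    by (intro poly_eqI) (simp add: coeff_map_poly coeff_pCons split: nat.split)
  then show ?thesis
    by (simp add: log_subst_def pcompose_pCons)
qed

lemma log_subst_const [simp]: "log_subst s [:f:] = [:f oo s:]"
  by (simp add: log_subst_pCons)

lemma log_subst_1 [simp]: "log_subst s 1 = 1"
  by (simp add: one_pCons)

lemma log_subst_add: "log_subst s (y + z) = log_subst s y + log_subst s z"
proof (induction y z rule: poly_induct2)
  case (pCons f y g z)
  then show ?case
    by (simp add: log_subst_pCons fps_compose_add_distrib algebra_simps)
qed simp

lemma log_subst_smult:
  assumes "fps_nth s 0 = 0"
  shows "log_subst s (smult f y) = smult (f oo s) (log_subst s y)"
  by (induction y) (simp_all add: log_subst_pCons fps_compose_mult_distrib[OF assms] smult_add_right)

lemma log_subst_mult: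
  assumes "fps_nth s 0 = 0"
  shows "log_subst s (y * z) = log_subst s y * log_subst s z"
proof (induction y)
  case (pCons f y)
  then show ?case
    by (simp add: log_subst_pCons log_subst_add log_subst_smult[OF assms] algebra_simps)
qed simp

lemma log_subst_diff: "log_subst s (y - z) = log_subst s y - log_subst s z"
  using log_subst_add[of s "y - z" z] by simp

lemma fps_ln_compose_exp:
  assumes "fps_nth h 0 = 0"
  shows "fps_ln 1 oo ((fps_exp 1 oo h) - 1) = (h :: 'k::field_char_0 fps)"
proof -
  have "(fps_exp 1 oo h) - 1 = (fps_exp 1 - 1) oo h"
    by (simp add: fps_compose_sub_distrib)
  then have "fps_ln 1 oo ((fps_exp 1 oo h) - 1) = (fps_ln 1 oo (fps_exp 1 - 1)) oo h"
    by (simp add: fps_compose_assoc[OF assms])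
  also have "fps_ln 1 oo (fps_exp 1 - 1) = (fps_X :: 'k fps)"
    by (simp add: fps_ln_fps_exp_inv fps_inv_fps_exp_compose)
  finally show ?thesis using assms by simp
qed

text \<open>
  For two power series without constant term, both \<open>exp f * exp (- f)\<close> and
  \<open>exp (f + g) * exp (- f) * exp (- g)\<close> have derivative zero and constant term one.
\<close>
lemma fps_exp_compose_add:
  fixes f g :: "'k::field_char_0 fps"
  assumes f: "fps_nth f 0 = 0" and g: "fps_nth g 0 = 0"
  shows "fps_exp 1 oo (f + g) = (fps_exp 1 oo f) * (fps_exp 1 oo g)"
proof -
  let ?E = "\<lambda>f. fps_exp (1 :: 'k) oo f"
  have d: "fps_deriv (?E f) = ?E f * fps_deriv f" if "fps_nth f 0 = 0" for f :: "'k fps"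
    using that by (simp add: fps_compose_deriv)
  have u: "?E f * ?E (- f) = 1" if f: "fps_nth f 0 = 0" for f :: "'k fps"
  proof -
    have "fps_deriv (?E f * ?E (- f)) = 0"
      using f by (simp add: d algebra_simps)
    then show ?thesis
      by (subst (asm) fps_deriv_eq_0_iff) (use f in simp)
  qed
  have "fps_deriv (?E (f + g) * (?E (- f) * ?E (- g))) = 0"
    using f g by (simp add: d algebra_simps)
  then have "?E (f + g) * (?E (- f) * ?E (- g)) = 1"
    by (subst (asm) fps_deriv_eq_0_iff) (use f g in simp)
  then have "?E f * ?E g = ?E f * ?E g * (?E (f + g) * (?E (- f) * ?E (- g)))"
    by simp
  also have "\<dots> = (?E f * ?E (- f)) * (?E g * ?E (- g)) * ?E (f + g)"
    by (simp only: mult_ac)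
  also have "\<dots> = ?E (f + g)"
    by (simp add: u f g)
  finally show ?thesis by simp
qed

text \<open>
  All substitutions below have the shape \<open>t \<mapsto> t ^ m * exp h\<close>, because both the inverse of the
  canonical coordinate and the Frobenius lift are given through \<open>q = t exp (F 1 / F 0)\<close>. For
  these the logarithm \<open>m log t + h\<close> and the logarithmic derivative \<open>m + \<theta> h\<close> are immediate.
\<close>
lemma log_series_X_power_exp:
  assumes "fps_nth h 0 = 0"
  shows "log_series (fps_X ^ m * (fps_exp 1 oo h)) = [:h, of_nat m:]"
proof -
  let ?u = "fps_exp 1 oo h"
  have u: "fps_nth ?u 0 = 1" by simp
  then have [simp]: "?u \<noteq> 0" by (metis fps_zero_nth zero_neq_one)
  have "subdegree (fps_X ^ m * ?u) = m"
    by (rule subdegreeI) (auto simp: fps_X_power_mult_nth)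
  then show ?thesis
    using fps_ln_compose_exp[OF assms]
    by (simp add: log_series_def mult.commute[of "fps_X ^ m"] fps_shift_times_fps_X_power)
qed

lemma theta_X_power_exp:
  assumes "fps_nth h 0 = 0"
  shows "theta (fps_X ^ m * (fps_exp 1 oo h))
    = fps_X ^ m * (fps_exp 1 oo h) * (of_nat m + theta h)"
proof -
  have "theta (fps_X ^ m :: 'a fps) = of_nat m * fps_X ^ m"
    by (rule fps_ext) (auto simp flip: fps_of_nat)
  moreover have "theta (fps_exp 1 oo h) = (fps_exp 1 oo h) * theta h"
    using assms by (simp add: theta_compose)
  ultimately show ?thesis
    by (simp add: theta_mult algebra_simps)
qed

text \<open>
  The chain rule. Both sides are derivations along the ring homomorphism \<open>y \<mapsto> y(s)\<close>, so they
  agree once they agree on power series and on \<open>log t\<close>.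
\<close>
lemma theta_log_subst:
  assumes h: "fps_nth h 0 = 0" and m: "m > 0"
    and s: "s = fps_X ^ m * (fps_exp 1 oo h)"
  shows "theta_log (log_subst s y) = smult (of_nat m + theta h) (log_subst s (theta_log y))"
proof -
  have s0: "fps_nth s 0 = 0"
    using m by (simp add: s)
  have ls: "log_series s = [:h, of_nat m:]"
    using h by (simp add: s log_series_X_power_exp)
  have ths: "theta s = s * (of_nat m + theta h)"
    unfolding s by (rule theta_X_power_exp[OF h])
  have th: "theta (f oo s) = (theta f oo s) * (of_nat m + theta h)" for f
    using s0 by (simp add: theta_compose ths)
      (simp add: theta_def fps_compose_mult_distrib algebra_simps)
  have dl: "theta_log [:h, of_nat m:] = [:of_nat m + theta h:]"
    by (simp add: theta_log_pCons add.commute flip: fps_of_nat)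
  show ?thesis
  proof (induction y)
    case (pCons f y)
    have "theta_log (pCons f y) = [:theta f:] + (y + pCons 0 (theta_log y))"
      by (simp add: theta_log_pCons)
    moreover have "log_subst s (pCons 0 (theta_log y)) = [:h, of_nat m:] * log_subst s (theta_log y)"
      by (simp add: log_subst_pCons ls)
    ultimately have "log_subst s (theta_log (pCons f y))
        = [:theta f oo s:] + log_subst s y + [:h, of_nat m:] * log_subst s (theta_log y)"
      by (simp add: log_subst_add)
    moreover have "theta_log (log_subst s (pCons f y))
        = [:theta (f oo s):] + theta_log [:h, of_nat m:] * log_subst s y
          + [:h, of_nat m:] * theta_log (log_subst s y)"
      by (simp only: log_subst_pCons ls theta_log_add theta_log_mult theta_log_const) (simp only: add.assoc)
    ultimately show ?case
      unfolding pCons.IH dl th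
      by (simp add: smult_add_right algebra_simps)
  qed simp
qed

section \<open>Solutions are determined at the origin\<close>

text \<open>
  The polynomial in \<open>log t\<close> that stands at \<open>t ^ n\<close>. On it \<open>\<theta>\<close> acts as \<open>n + d/d(log t)\<close>, which
  is invertible for \<open>n > 0\<close>; this is why solutions are determined by their part at \<open>n = 0\<close>.
\<close>
definition log_part :: "nat \<Rightarrow> 'k::field_char_0 fps poly \<Rightarrow> 'k poly" where
  "log_part n y = map_poly (\<lambda>f. fps_nth f n) y"

lemma coeff_log_part [simp]: "coeff (log_part n y) j = fps_nth (coeff y j) n"
  by (simp add: log_part_def coeff_map_poly)

lemma log_part_add: "log_part n (y + z) = log_part n y + log_part n z"
  and log_part_diff: "log_part n (y - z) = log_part n y - log_part n z"
  and log_part_uminus: "log_part n (- y) = - log_part n y"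
  and log_part_zero [simp]: "log_part n 0 = 0"
  by (auto intro!: poly_eqI)

lemma log_part_theta_log:
  "log_part n (theta_log y) = smult (of_nat n) (log_part n y) + pderiv (log_part n y)"
proof (intro poly_eqI)
  fix j
  have "fps_nth (of_nat (Suc j) * f) n = of_nat (Suc j) * fps_nth f n" for f :: "'a fps"
    by (metis fps_mult_left_const_nth fps_of_nat)
  then show "coeff (log_part n (theta_log y)) j =
      coeff (smult (of_nat n) (log_part n y) + pderiv (log_part n y)) j"
    by (simp add: coeff_theta_log coeff_pderiv del: of_nat_Suc)
qed

lemma log_part_0_mult: "log_part 0 (y * z) = log_part 0 y * log_part 0 z"
  by (intro poly_eqI) (simp add: coeff_mult fps_sum_nth)

lemma log_part_0_smult: "log_part 0 (smult f z) = smult (fps_nth f 0) (log_part 0 z)"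
  by (intro poly_eqI) simp

lemma log_part_0_theta_log: "log_part 0 (theta_log y) = pderiv (log_part 0 y)"
  by (simp add: log_part_theta_log)

lemma log_part_pCons: "log_part n (pCons f y) = pCons (fps_nth f n) (log_part n y)"
  by (intro poly_eqI) (simp add: coeff_pCons split: nat.split)

lemma log_part_0_log_subst:
  assumes "fps_nth h 0 = 0" "log_series s = [:h, of_nat m:]"
  shows "log_part 0 (log_subst s y) = pcompose (log_part 0 y) [:0, of_nat m:]"
  using assms(1)
  by (induction y) (simp_all add: log_subst_pCons log_part_add log_part_0_smult log_part_pCons
      pcompose_pCons assms(2))

text \<open>Divisibility by \<open>t ^ n\<close>.\<close>

definition vanishes :: "nat \<Rightarrow> 'k::field_char_0 fps poly \<Rightarrow> bool" where
  "vanishes n y \<longleftrightarrow> (\<forall>i<n. log_part i y = 0)"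

lemma vanishes_0 [simp]: "vanishes n 0"
  by (simp add: vanishes_def)

lemma vanishes_add: "vanishes n y \<Longrightarrow> vanishes n z \<Longrightarrow> vanishes n (y + z)"
  and vanishes_diff: "vanishes n y \<Longrightarrow> vanishes n z \<Longrightarrow> vanishes n (y - z)"
  and vanishes_uminus: "vanishes n y \<Longrightarrow> vanishes n (- y)"
  by (simp_all add: vanishes_def log_part_add log_part_diff log_part_uminus)

lemma vanishes_sum: "(\<And>i. i \<in> I \<Longrightarrow> vanishes n (y i)) \<Longrightarrow> vanishes n (sum y I)"
  by (induction I rule: infinite_finite_induct) (simp_all add: vanishes_add)

lemma vanishes_iff: "vanishes n y \<longleftrightarrow> (\<forall>j. \<forall>i<n. fps_nth (coeff y j) i = 0)"
  by (auto simp: vanishes_def poly_eq_iff)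

lemma vanishes_smult: "vanishes n y \<Longrightarrow> vanishes n (smult f y)"
  by (auto simp: vanishes_iff fps_mult_nth intro!: sum.neutral)

lemma vanishes_Suc_smult: "vanishes n y \<Longrightarrow> fps_nth f 0 = 0 \<Longrightarrow> vanishes (Suc n) (smult f y)"
  unfolding vanishes_iff
proof (intro allI impI)
  fix j i assume y: "\<forall>j. \<forall>i<n. fps_nth (coeff y j) i = 0" and f: "fps_nth f 0 = 0" and i: "i < Suc n"
  have "fps_nth f k * fps_nth (coeff y j) (i - k) = 0" if "k \<le> i" for k
    using y f i that by (cases k) auto
  then show "fps_nth (coeff (smult f y) j) i = 0"
    by (auto simp: fps_mult_nth intro!: sum.neutral)
qed

lemma vanishes_theta_log: "vanishes n y \<Longrightarrow> vanishes n (theta_log y)"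
  by (simp add: vanishes_def log_part_theta_log)

text \<open>
  Differentiation lowers the degree, so it cannot cancel a nonzero multiple of the leading
  coefficient.
\<close>
lemma smult_add_pderiv_eq_0:
  fixes c :: "'k::field_char_0 poly"
  assumes "smult a c + pderiv c = 0" "a \<noteq> 0"
  shows "c = 0"
proof (rule ccontr)
  assume c: "c \<noteq> 0"
  have "coeff (smult a c + pderiv c) (degree c) = a * lead_coeff c"
    by (simp add: coeff_pderiv coeff_eq_0)
  with c assms show False by simp
qed

lemma vanishes_Suc_if_theta_log:
  assumes "vanishes n y" "n > 0" "vanishes (Suc n) (theta_log y)"
  shows "vanishes (Suc n) y"
proof -
  have "log_part n (theta_log y) = 0"
    using assms(3) by (simp add: vanishes_def)
  then have "smult (of_nat n) (log_part n y) + pderiv (log_part n y) = 0"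
    by (simp only: log_part_theta_log)
  then have "log_part n y = 0"
    by (rule smult_add_pderiv_eq_0) (use assms(2) in simp)
  with assms(1) show ?thesis
    by (metis vanishes_def less_Suc_eq)
qed

lemma eq_0_if_vanishes:
  assumes "\<And>n. n > 0 \<Longrightarrow> vanishes n y"
  shows "y = 0"
proof (intro poly_eqI fps_ext)
  fix j i show "fps_nth (coeff y j) i = fps_nth (coeff 0 j) i"
    using assms[of "Suc i"] by (simp add: vanishes_iff)
qed

lemma vanishes_induct:
  assumes "vanishes 1 y" "\<And>n. n > 0 \<Longrightarrow> vanishes n y \<Longrightarrow> vanishes (Suc n) y"
  shows "y = 0"
proof (rule eq_0_if_vanishes)
  fix n :: nat assume "n > 0"
  then show "vanishes n y"
    by (induction n rule: nat_induct_non_zero) (use assms in auto)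
qed

lemma sum_less_4: "(\<Sum>i<4. f i) = f 0 + f 1 + f 2 + f 3" for f :: "nat \<Rightarrow> 'a::comm_monoid_add"
  by (simp add: eval_nat_numeral)

text \<open>
  Since the \<open>a i\<close> vanish at the origin, the equation makes \<open>\<theta>^4 y\<close> vanish to one order more
  than \<open>y\<close>; for positive orders this gain passes back from \<open>\<theta>^4 y\<close> to \<open>y\<close>.
\<close>
lemma solution_eq_0:
  assumes a: "\<forall>i<4. fps_nth (a i) 0 = 0" and sol: "is_solution a y" and init: "log_part 0 y = 0"
  shows "y = 0"
proof (rule vanishes_induct)
  show "vanishes 1 y" using init by (simp add: vanishes_def)
next
  fix n :: nat assume n: "n > 0" and y: "vanishes n y"
  have v: "vanishes n ((theta_log ^^ i) y)" for i
    by (induction i) (simp_all add: y vanishes_theta_log)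
  have "(theta_log ^^ 4) y = - (\<Sum>i<4. smult (a i) ((theta_log ^^ i) y))"
    using sol by (simp add: is_solution_def diff_op_def eq_neg_iff_add_eq_0)
  moreover have "vanishes (Suc n) \<dots>"
    using a v by (intro vanishes_uminus vanishes_sum vanishes_Suc_smult) auto
  ultimately have 4: "vanishes (Suc n) ((theta_log ^^ 4) y)"
    by simp
  have step: "vanishes (Suc n) ((theta_log ^^ i) y)" if "vanishes (Suc n) ((theta_log ^^ Suc i) y)" for i
    using vanishes_Suc_if_theta_log[OF v n] that by simp
  show "vanishes (Suc n) y"
    using step[of 0] step[of 1] step[of 2] step[of 3] 4 by (simp add: eval_nat_numeral)
qed

lemma diff_op_add: "diff_op a (y + z) = diff_op a y + diff_op a z"
proof -
  have "(theta_log ^^ i) (y + z) = (theta_log ^^ i) y + (theta_log ^^ i) z" for i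
    by (induction i) (simp_all add: theta_log_add)
  then show ?thesis
    by (simp add: diff_op_def smult_add_right sum.distrib algebra_simps)
qed

lemma diff_op_smult_const: "diff_op a (smult (fps_const c) y) = smult (fps_const c) (diff_op a y)"
proof -
  have "(theta_log ^^ i) (smult (fps_const c) y) = smult (fps_const c) ((theta_log ^^ i) y)" for i
    by (induction i) (simp_all add: theta_log_smult)
  moreover have "smult f (smult (fps_const c) x) = smult (fps_const c) (smult f x)" for f x
    by (simp add: mult.commute)
  ultimately show ?thesis
    by (simp add: diff_op_def smult_add_right smult_sum2 del: smult_smult)
qed

lemma is_solution_add: "is_solution a y \<Longrightarrow> is_solution a z \<Longrightarrow> is_solution a (y + z)"
  by (simp add: is_solution_def diff_op_add)

lemma is_solution_smult_const: "is_solution a y \<Longrightarrow> is_solution a (smult (fps_const c) y)"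
  by (simp add: is_solution_def diff_op_smult_const)

lemma solution_eqI:
  assumes a: "\<forall>i<4. fps_nth (a i) 0 = 0" and "is_solution a y" "is_solution a z" "log_part 0 y = log_part 0 z"
  shows "y = z"
proof -
  have "is_solution a (y + smult (fps_const (- 1)) z)"
    using assms by (intro is_solution_add is_solution_smult_const)
  moreover have "y + smult (fps_const (- 1)) z = y - z"
    by (simp add: poly_eq_iff flip: fps_const_neg)
  ultimately show ?thesis
    using solution_eq_0[OF a, of "y - z"] assms(4) by (simp add: log_part_diff)
qed

section \<open>The pairing of the standard basis for a self-dual equation\<close>

definition wronskian :: "nat \<Rightarrow> nat \<Rightarrow> 'k::field_char_0 fps poly \<Rightarrow> 'k fps poly \<Rightarrow> 'k fps poly" where
  "wronskian k l y z =
     (theta_log ^^ k) y * (theta_log ^^ l) z - (theta_log ^^ l) y * (theta_log ^^ k) z"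

lemma theta_log_wronskian:
  "theta_log (wronskian k l y z) = wronskian (Suc k) l y z + wronskian k (Suc l) y z"
  by (simp add: wronskian_def theta_log_diff theta_log_mult algebra_simps)

lemma wronskian_same [simp]: "wronskian k k y z = 0"
  by (simp add: wronskian_def)

lemma wronskian_swap: "wronskian l k y z = - wronskian k l y z"
  by (simp add: wronskian_def)

lemma solution_theta_log_4:
  assumes "is_solution a y"
  shows "(theta_log ^^ 4) y = - ([:a 0:] * y + [:a 1:] * (theta_log ^^ 1) y
     + [:a 2:] * (theta_log ^^ 2) y + [:a 3:] * (theta_log ^^ 3) y)"
  unfolding eq_neg_iff_add_eq_0
  using assms by (simp add: is_solution_def diff_op_def sum_less_4)

text \<open>
  The equation expresses the fourth derivatives of \<open>y\<close> and \<open>z\<close> by lower ones with the same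
  coefficients, so the Wronskians are closed under \<open>\<theta>\<close>.
\<close>
lemma wronskian_4:
  assumes "is_solution a y" "is_solution a z"
  shows "wronskian k 4 y z = - ([:a 0:] * wronskian k 0 y z + [:a 1:] * wronskian k 1 y z
     + [:a 2:] * wronskian k 2 y z + [:a 3:] * wronskian k 3 y z)"
proof -
  have "p * - (A * v0 + B * v1 + C * v2 + D * v3) - - (A * u0 + B * u1 + C * u2 + D * u3) * q
    = - (A * (p * v0 - u0 * q) + B * (p * v1 - u1 * q) + C * (p * v2 - u2 * q) + D * (p * v3 - u3 * q))"
    for A B C D p q u0 u1 u2 u3 v0 v1 v2 v3 :: "'a fps poly"
    by (simp add: algebra_simps)
  then show ?thesis
    unfolding wronskian_def solution_theta_log_4[OF assms(1)] solution_theta_log_4[OF assms(2)] funpow_0 .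
qed

lemma log_part_0_funpow_theta_log: "log_part 0 ((theta_log ^^ k) y) = (pderiv ^^ k) (log_part 0 y)"
  by (induction k) (simp_all add: log_part_0_theta_log)

lemma log_part_0_std_form:
  assumes "standard_basis a F" "i \<le> 3"
  shows "log_part 0 (std_form F i) = monom (1 / fact i) i"
proof (intro poly_eqI)
  fix j
  have "fps_nth (F (i - j)) 0 = (if j = i then 1 else 0)" if "j \<le> i"
    using assms that by (cases "j = i") (auto simp: standard_basis_def dest!: bspec[of _ _ "i - j"])
  then show "coeff (log_part 0 (std_form F i)) j = coeff (monom (1 / fact i) i) j"
    by (simp add: std_form_def coeff_sum fps_sum_nth if_distrib sum.delta' cong: if_cong)
qed

lemma vanishes_mult_const_Suc: "vanishes n y \<Longrightarrow> fps_nth f 0 = 0 \<Longrightarrow> vanishes (Suc n) ([:f:] * y)"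
  by (simp add: vanishes_Suc_smult)

lemma vanishes_two_mult: "vanishes n (2 * y) \<Longrightarrow> vanishes n y"
proof -
  assume "vanishes n (2 * y)"
  then have "vanishes n (smult (fps_const (1/2)) (2 * y))"
    by (rule vanishes_smult)
  moreover have "smult (fps_const (1/2)) (2 * y) = y"
    by (simp add: numeral_poly fps_numeral_fps_const)
  ultimately show ?thesis by simp
qed

text \<open>
  Let \<open>w k l\<close> be the difference of the Wronskians of \<open>y_0, y_3\<close> and of \<open>y_1, y_2\<close>. The six
  functions \<open>w k l\<close> with \<open>k < l\<close> satisfy a linear system of first order. Under the
  self-duality condition, five linear combinations \<open>x1, \<dots>, x5\<close> of them satisfy a closed system
  among themselves. That system is nilpotent at the origin, where all five vanish, so they vanish
  identically; the claim is \<open>x1 = 0\<close>. The factors 2 and 4 in \<open>x4\<close> and \<open>x5\<close> clear the denominators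
  in the self-duality condition.
\<close>
theorem self_dual_pairing:
  assumes a0: "\<forall>i<4. fps_nth (a i) 0 = 0" and sb: "standard_basis a F" and sd: "self_dual a"
  shows "std_form F 0 * theta_log (std_form F 3) - std_form F 3 * theta_log (std_form F 0)
    = std_form F 1 * theta_log (std_form F 2) - std_form F 2 * theta_log (std_form F 1)"
proof -
  let ?y = "std_form F"
  define w where "w k l = wronskian k l (?y 0) (?y 3) - wronskian k l (?y 1) (?y 2)" for k l
  have sol: "is_solution a (?y i)" if "i \<le> 3" for i
    using sb that by (simp add: standard_basis_def)
  have dw: "theta_log (w k l) = w (Suc k) l + w k (Suc l)" for k l
    by (simp add: w_def theta_log_diff theta_log_wronskian)
  have w4: "w k 4 = - ([:a 0:] * w k 0 + [:a 1:] * w k 1 + [:a 2:] * w k 2 + [:a 3:] * w k 3)" for k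
    by (simp add: w_def wronskian_4[OF sol sol] algebra_simps smult_diff_right)
  have swap: "w l k = - w k l" for k l
    unfolding w_def wronskian_swap[of l] by simp
  have same: "w k k = 0" for k
    by (simp add: w_def)
  note [simp del] = One_nat_def
  have Sucs: "Suc 0 = 1" "Suc 1 = 2" "Suc 2 = 3" "Suc 3 = 4"
    by (simp_all add: One_nat_def)
  define c where "c i = [:a i:]" for i
  have 8: "8 * c 1 = 4 * c 2 * c 3 - c 3 ^ 3 + 8 * theta_log (c 2) - 6 * c 3 * theta_log (c 3)
      - 4 * theta_log (theta_log (c 3))"
  proof -
    have "8 * a 1 = 4 * a 2 * a 3 - a 3 ^ 3 + 8 * theta (a 2) - 6 * a 3 * theta (a 3)
      - 4 * theta (theta (a 3))"
    proof -
      have k: "8 * fps_const (1/2) = (4 :: 'a fps)" "8 * fps_const (1/8) = (1 :: 'a fps)"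
        "8 * fps_const (3/4) = (6 :: 'a fps)"
        by (simp_all add: fps_numeral_fps_const)
      have "8 * a 1 = (8 * fps_const (1/2)) * a 2 * a 3 - (8 * fps_const (1/8)) * a 3 ^ 3 + 8 * theta (a 2)
        - (8 * fps_const (3/4)) * a 3 * theta (a 3) - (8 * fps_const (1/2)) * theta (theta (a 3))"
        by (subst sd[unfolded self_dual_def]) (simp only: algebra_simps)
      then show ?thesis unfolding k by simp
    qed
    then have "[:8 * a 1:] = [:4 * a 2 * a 3 - a 3 ^ 3 + 8 * theta (a 2) - 6 * a 3 * theta (a 3)
      - 4 * theta (theta (a 3)):]" by simp
    then show ?thesis
      by (simp add: c_def numeral_poly power3_eq_cube algebra_simps)
  qed
  \<comment> \<open>The coefficient of \<open>w 1 2\<close> in \<open>x5\<close> is chosen so that \<open>2 \<theta> x4\<close> involves \<open>x1\<close>, \<open>x4\<close> and \<open>x5\<close> only.\<close>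
  define b where "b = 2 * theta_log (c 3) + c 3 ^ 2 - 4 * c 2"
  define x1 where "x1 = w 0 1"
  define x2 where "x2 = w 0 2"
  define x3 where "x3 = w 0 3 + w 1 2"
  define x4 where "x4 = 2 * w 1 3 + c 3 * w 1 2"
  define x5 where "x5 = 4 * w 2 3 + b * w 1 2"
  have tnum: "theta_log (numeral k * z) = numeral k * theta_log z" for k and z :: "'a fps poly"
  proof -
    have "theta_log (of_nat n * z) = of_nat n * theta_log z" for n
      by (induction n) (simp_all add: theta_log_add algebra_simps)
    from this[of "numeral k"] show ?thesis by simp
  qed
  have tnum1: "theta_log (numeral k :: 'a fps poly) = 0" for k
    using tnum[of k 1] by simp
  have w: "theta_log (w 0 1) = w 0 2" "theta_log (w 0 2) = w 1 2 + w 0 3"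
    "theta_log (w 1 2) = w 1 3"
    "theta_log (w 0 3) = w 1 3 - (c 1 * w 0 1 + c 2 * w 0 2 + c 3 * w 0 3)"
    "theta_log (w 1 3) = w 2 3 - (c 2 * w 1 2 + c 3 * w 1 3 - c 0 * w 0 1)"
    "theta_log (w 2 3) = c 0 * w 0 2 + c 1 * w 1 2 - c 3 * w 2 3"
    using w4[of 0] w4[of 1] w4[of 2] swap[of 1 0] swap[of 2 0] swap[of 2 1] same
    by (simp_all add: dw Sucs c_def)
  have d: "theta_log x1 = x2" "theta_log x2 = x3"
    "theta_log x3 = x4 - (c 1 * x1 + c 2 * x2 + c 3 * x3)"
    "2 * theta_log x4 = x5 + (4 * (c 0 * x1) - c 3 * x4)"
    by (simp_all add: x1_def x2_def x3_def x4_def x5_def b_def theta_log_add theta_log_mult tnum tnum1 w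
        algebra_simps power2_eq_square)
  \<comment> \<open>What keeps the system from closing is a multiple of \<open>w 1 2\<close>, and its factor is the defect of self-duality.\<close>
  have "2 * theta_log x5 - (8 * (c 0 * x2) - 2 * (c 3 * x5) + b * x4)
     = (8 * c 1 - (4 * c 2 * c 3 - c 3 ^ 3 + 8 * theta_log (c 2) - 6 * c 3 * theta_log (c 3)
      - 4 * theta_log (theta_log (c 3)))) * w 1 2"
    by (simp add: x2_def x4_def x5_def b_def theta_log_add theta_log_diff theta_log_mult tnum tnum1 w
        algebra_simps power2_eq_square power3_eq_cube)
  then have d5: "2 * theta_log x5 = 8 * (c 0 * x2) - 2 * (c 3 * x5) + b * x4"
    using 8 by simp
  have b0: "\<exists>f. b = [:f:] \<and> fps_nth f 0 = 0"
    by (rule exI[of _ "2 * theta (a 3) + a 3 ^ 2 - 4 * a 2"])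
       (use a0 in \<open>simp add: b_def c_def numeral_poly power2_eq_square fps_numeral_nth\<close>)
  then obtain f where f: "b = [:f:]" "fps_nth f 0 = 0" by blast
  have c0: "vanishes (Suc n) (c i * z)" if "vanishes n z" "i < 4" for i n z
    using that a0 by (simp add: c_def vanishes_Suc_smult)
  have num: "vanishes n (numeral k * z)" if "vanishes n z" for k n and z :: "'a fps poly"
    using vanishes_smult[OF that, of "numeral k"] by (simp add: numeral_poly)
  have "vanishes n x1 \<and> vanishes n x2 \<and> vanishes n x3 \<and> vanishes n x4 \<and> vanishes n x5" if "n > 0" for n
    using that
  proof (induction n rule: nat_induct_non_zero)
    case 1
    have l: "log_part 0 ((theta_log ^^ k) (?y i)) = (pderiv ^^ k) (monom (1 / fact i) i)" if "i \<le> 3" for i k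
      using log_part_0_std_form[OF sb that] by (simp add: log_part_0_funpow_theta_log)
    have "log_part 0 (w k l) = (pderiv ^^ k) (monom (1 / fact 0) 0) * (pderiv ^^ l) (monom (1 / fact 3) 3)
      - (pderiv ^^ l) (monom (1 / fact 0) 0) * (pderiv ^^ k) (monom (1 / fact 3) 3)
      - ((pderiv ^^ k) (monom (1 / fact 1) 1) * (pderiv ^^ l) (monom (1 / fact 2) 2)
      - (pderiv ^^ l) (monom (1 / fact 1) 1) * (pderiv ^^ k) (monom (1 / fact 2) 2))" for k l
      unfolding w_def wronskian_def log_part_diff log_part_0_mult by (simp only: l)
    then have "log_part 0 (w 0 1) = 0 \<and> log_part 0 (w 0 2) = 0 \<and> log_part 0 (w 0 3 + w 1 2) = 0
       \<and> log_part 0 (w 1 3) = 0 \<and> log_part 0 (w 2 3) = 0"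
      by (simp add: One_nat_def log_part_add eval_nat_numeral pderiv_monom monom_Suc monom_0 pderiv_pCons)
    moreover have "log_part 0 (c 3) = 0" "log_part 0 b = 0"
      using a0 f(2) by (simp_all add: c_def f(1) log_part_pCons)
    ultimately show ?case
      by (simp add: vanishes_def x1_def x2_def x3_def x4_def x5_def log_part_0_mult
          log_part_add[of _ "_ * _"])
  next
    case (Suc n)
    then have v: "vanishes n x1" "vanishes n x2" "vanishes n x3" "vanishes n x4" "vanishes n x5"
      by auto
    note up = vanishes_Suc_if_theta_log[OF _ Suc.hyps]
    \<comment> \<open>The system is triangular at the origin, so the gain of one order starts at \<open>x5\<close> and moves down to \<open>x1\<close>.\<close>
    have 5: "vanishes (Suc n) x5"
      by (rule up[OF v(5)], rule vanishes_two_mult, unfold d5 f(1))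
         (intro vanishes_add vanishes_diff num c0 v vanishes_mult_const_Suc f; simp)
    have 4: "vanishes (Suc n) x4"
      by (rule up[OF v(4)], rule vanishes_two_mult, unfold d)
         (intro vanishes_add vanishes_diff num c0 v 5; simp)
    have 3: "vanishes (Suc n) x3"
      by (rule up[OF v(3)], unfold d) (intro vanishes_add vanishes_diff c0 v 4; simp)
    have 2: "vanishes (Suc n) x2"
      by (rule up[OF v(2)], unfold d) (rule 3)
    have 1: "vanishes (Suc n) x1"
      by (rule up[OF v(1)], unfold d) (rule 2)
    show ?case using 1 2 3 4 5 by blast
  qed
  then have "w 0 1 = 0"
    by (intro eq_0_if_vanishes) (simp add: x1_def)
  then show ?thesis
    by (simp add: w_def wronskian_def One_nat_def algebra_simps)
qed

section \<open>The canonical coordinate\<close>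

(* The index 1 in \<open>F 1\<close> and \<open>B 1\<close> should not be rewritten to \<open>Suc 0\<close>. *)
declare One_nat_def [simp del]

lemma theta_of_nat [simp]: "theta (of_nat n) = 0"
  by (simp flip: fps_of_nat)

text \<open>
  The element \<open>y_1 / y_0 = log q\<close>.
\<close>
definition log_q :: "(nat \<Rightarrow> 'k::field_char_0 fps) \<Rightarrow> 'k fps poly" where
  "log_q F = [:F 1 / F 0, 1:]"

text \<open>
  The series \<open>\<theta> (log q) = (\<theta> q) / q\<close>, so that \<open>\<theta>\<close> is this multiple of \<open>\<theta>_q\<close>.
\<close>
definition theta_log_coord :: "(nat \<Rightarrow> 'k::field_char_0 fps) \<Rightarrow> 'k fps" where
  "theta_log_coord F = 1 + theta (F 1 / F 0)"

abbreviation theta_q :: "(nat \<Rightarrow> 'k::field_char_0 fps) \<Rightarrow> 'k fps poly \<Rightarrow> 'k fps poly" where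
  "theta_q F \<equiv> scaled_theta (inverse (theta_log_coord F))"

lemma theta_log_coord_nth_0 [simp]: "fps_nth (theta_log_coord F) 0 = 1"
  by (simp add: theta_log_coord_def)

lemma theta_log_coord_inverse [simp]:
  "theta_log_coord F * inverse (theta_log_coord F) = 1"
  "inverse (theta_log_coord F) * theta_log_coord F = 1"
  using inverse_mult_eq_1[of "theta_log_coord F"] by (simp_all add: mult.commute)

lemma theta_log_eq_theta_q: "theta_log y = smult (theta_log_coord F) (theta_q F y)"
  by (simp add: scaled_theta_def)

lemma theta_log_log_q: "theta_log (log_q F) = [:theta_log_coord F:]"
  by (simp add: log_q_def theta_log_coord_def theta_log_pCons add.commute one_pCons)

lemma theta_q_log_q [simp]: "theta_q F (log_q F) = 1"
  by (simp add: scaled_theta_def theta_log_log_q one_pCons)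

lemma fps_exp_compose_minus:
  assumes "fps_nth f 0 = (0 :: 'k::field_char_0)"
  shows "(fps_exp 1 oo f) * (fps_exp 1 oo (- f)) = 1"
  using fps_exp_compose_add[of f "- f"] assms by simp

text \<open>
  A substitution \<open>s\<close> is controlled by its effect on \<open>q\<close>. If \<open>q(s) = t ^ m * exp h\<close> then
  \<open>log q\<close> becomes \<open>m log t + h\<close>. Differentiating this relation determines the factor in the chain
  rule for \<open>s\<close>: the unknown logarithmic derivative of \<open>s\<close> is eliminated in favour of that of
  \<open>t ^ m * exp h\<close>, at the price of replacing \<open>\<theta>\<close> by \<open>\<theta>_q\<close> inside.
\<close>
lemma coordinate_lift:
  fixes F :: "nat \<Rightarrow> 'k::field_char_0 fps"
  assumes F: "fps_nth (F 1) 0 = 0" "fps_nth (F 0) 0 = 1" and s0: "fps_nth s 0 = 0" and h: "fps_nth h 0 = 0" and m: "m > 0"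
    and s: "canonical_coord F oo s = fps_X ^ m * (fps_exp 1 oo h)"
  obtains h' where "fps_nth h' 0 = 0" "s = fps_X ^ m * (fps_exp 1 oo h')"
    "log_subst s (log_q F) = [:h, of_nat m:]"
    "\<And>y. theta_log (log_subst s y) = smult (of_nat m + theta h) (log_subst s (theta_q F y))"
proof -
  define f where "f = F 1 / F 0"
  have f: "fps_nth f 0 = 0"
    using F by (simp add: f_def fps_divide_unit)
  define h' where "h' = h + - (f oo s)"
  have h': "fps_nth h' 0 = 0" using h f by (simp add: h'_def)
  have "canonical_coord F oo s = s * ((fps_exp 1 oo f) oo s)"
    using s0 by (simp add: canonical_coord_def exp_ratio_def f_def fps_compose_mult_distrib)
  also have "(fps_exp 1 oo f) oo s = fps_exp 1 oo (f oo s)"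
    by (simp add: fps_compose_assoc s0 f)
  finally have "s * (fps_exp 1 oo (f oo s)) = fps_X ^ m * (fps_exp 1 oo h)"
    using s by simp
  then have "s * ((fps_exp 1 oo (f oo s)) * (fps_exp 1 oo (- (f oo s))))
      = fps_X ^ m * ((fps_exp 1 oo h) * (fps_exp 1 oo (- (f oo s))))"
    by (simp only: mult.assoc[symmetric])
  then have "s = fps_X ^ m * ((fps_exp 1 oo h) * (fps_exp 1 oo (- (f oo s))))"
    by (simp add: fps_exp_compose_minus f)
  then have s': "s = fps_X ^ m * (fps_exp 1 oo h')"
    unfolding h'_def by (subst fps_exp_compose_add) (simp_all add: h f)
  have q: "log_subst s (log_q F) = [:h, of_nat m:]"
    using log_series_X_power_exp[OF h', of m, folded s']
    by (simp add: log_q_def log_subst_pCons h'_def f_def)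
  have d: "theta_log (log_subst s y) = smult (of_nat m + theta h') (log_subst s (theta_log y))" for y
    by (rule theta_log_subst[OF h' m s'])
  have "theta_log (log_subst s (log_q F)) = [:of_nat m + theta h:]"
    by (simp add: q theta_log_pCons add.commute flip: fps_of_nat)
  then have "of_nat m + theta h = (of_nat m + theta h') * (theta_log_coord F oo s)"
    unfolding d theta_log_log_q by simp
  then have "theta_log (log_subst s y) = smult (of_nat m + theta h) (log_subst s (theta_q F y))" for y
    by (simp add: d theta_log_eq_theta_q[of y F] log_subst_smult s0 algebra_simps)
  with that h' s' q show ?thesis by blast
qed

lemma canonical_coord_nth: "fps_nth (canonical_coord F) 0 = 0" "fps_nth (canonical_coord F) 1 = 1"
  by (simp_all add: canonical_coord_def exp_ratio_def)

lemma t_of_q_nth_0: "fps_nth (t_of_q F) 0 = 0"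
  by (simp add: t_of_q_def fps_inv_def)

lemma canonical_coord_t_of_q: "canonical_coord F oo t_of_q F = fps_X"
  unfolding t_of_q_def by (rule fps_inv_right) (simp_all add: canonical_coord_nth[simplified])

lemma fps_exp_compose_of_nat:
  fixes f :: "'k::field_char_0 fps"
  assumes "fps_nth f 0 = 0"
  shows "(fps_exp 1 oo f) ^ m = fps_exp 1 oo (of_nat m * f)"
  by (induction m) (simp_all add: assms fps_exp_compose_add algebra_simps)

text \<open>
  Passing to the coordinate \<open>q\<close> turns \<open>\<theta>_q\<close> into \<open>q d/dq\<close>: here \<open>q(s) = t\<close>, that is, \<open>m = 1\<close>
  and \<open>h = 0\<close>.
\<close>
lemma theta_log_log_subst_t_of_q:
  assumes F: "fps_nth (F 1) 0 = 0" "fps_nth (F 0) 0 = 1"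
  shows "theta_log (log_subst (t_of_q F) y) = log_subst (t_of_q F) (theta_q F y)"
proof -
  have q: "canonical_coord F oo t_of_q F = fps_X ^ 1 * (fps_exp 1 oo 0)"
    by (simp add: canonical_coord_t_of_q)
  have "theta_log (log_subst (t_of_q F) y) = smult (of_nat 1 + theta 0) (log_subst (t_of_q F) (theta_q F y))"
    by (rule coordinate_lift[OF F t_of_q_nth_0 _ _ q]) auto
  then show ?thesis
    by simp
qed

text \<open>
  The image of \<open>t\<close> under \<open>q \<mapsto> q ^ m\<close>, which for \<open>m = p\<close> is the Frobenius lift. The relation
  between \<open>K(q)\<close> and \<open>K(q ^ m)\<close> below is a formal identity over a field of characteristic zero.
\<close>
definition power_lift :: "(nat \<Rightarrow> 'k::field_char_0 fps) \<Rightarrow> nat \<Rightarrow> 'k fps" where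
  "power_lift F m = t_of_q F oo canonical_coord F ^ m"

text \<open>
  Here \<open>q(s) = q ^ m = t ^ m * exp (m F 1 / F 0)\<close>.
\<close>
lemma power_lift_props:
  fixes F :: "nat \<Rightarrow> 'k::field_char_0 fps"
  assumes F: "fps_nth (F 1) 0 = 0" "fps_nth (F 0) 0 = 1" and m: "m > 0"
  obtains h where "fps_nth h 0 = 0" "power_lift F m = fps_X ^ m * (fps_exp 1 oo h)"
    "log_subst (power_lift F m) (log_q F) = of_nat m * log_q F"
    "\<And>y. theta_q F (log_subst (power_lift F m) y) = of_nat m * log_subst (power_lift F m) (theta_q F y)"
proof -
  define f where "f = F 1 / F 0"
  have f: "fps_nth f 0 = 0"
    using F by (simp add: f_def fps_divide_unit)
  let ?s = "power_lift F m"
  have q0: "fps_nth (canonical_coord F ^ m) 0 = 0"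
    using m by (simp add: canonical_coord_nth)
  have s0: "fps_nth ?s 0 = 0"
    by (simp add: power_lift_def t_of_q_nth_0)
  have "canonical_coord F oo ?s = canonical_coord F ^ m"
    using q0 by (simp add: power_lift_def fps_compose_assoc t_of_q_nth_0 canonical_coord_t_of_q)
  also have "\<dots> = fps_X ^ m * (fps_exp 1 oo (of_nat m * f))"
    by (simp add: canonical_coord_def exp_ratio_def f_def[symmetric] power_mult_distrib fps_exp_compose_of_nat f)
  finally have q: "canonical_coord F oo ?s = fps_X ^ m * (fps_exp 1 oo (of_nat m * f))" .
  have th: "theta (of_nat m * f) = of_nat m * theta f"
    by (simp add: theta_mult)
  show ?thesis
  proof (rule coordinate_lift[OF F s0 _ m q])
    show "fps_nth (of_nat m * f) 0 = 0" by (simp add: f)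
  next
    fix h assume h: "fps_nth h 0 = 0" "?s = fps_X ^ m * (fps_exp 1 oo h)"
      "log_subst ?s (log_q F) = [:of_nat m * f, of_nat m:]"
      "\<And>y. theta_log (log_subst ?s y) =
         smult (of_nat m + theta (of_nat m * f)) (log_subst ?s (theta_q F y))"
    have m_log_q: "of_nat m * log_q F = [:of_nat m * f, of_nat m:]"
      by (simp add: of_nat_poly log_q_def f_def)
    have "of_nat m + theta (of_nat m * f) = of_nat m * theta_log_coord F"
      by (simp add: theta_mult theta_log_coord_def f_def algebra_simps)
    then have "theta_q F (log_subst ?s y) = smult (of_nat m) (log_subst ?s (theta_q F y))" for y
      unfolding scaled_theta_def[of _ "log_subst ?s y"] h(4) by (simp add: mult.left_commute[of "inverse _"])
    then show ?thesis
      by (intro that[of h]) (use h m_log_q in \<open>simp_all add: of_nat_poly\<close>)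
  qed
qed

text \<open>
  Multiplication by a power series followed by a differential operator of order three is again
  one. Only its leading coefficient is needed explicitly; the others are found from its effect on
  solutions.
\<close>
lemma leibniz_theta_q:
  fixes F :: "nat \<Rightarrow> 'k::field_char_0 fps"
  obtains C0 C1 C2 where
    "\<And>y. (\<Sum>i<4. smult (B i) ((theta_log ^^ i) (smult f y))) =
       smult C0 y + smult C1 (theta_q F y) + smult C2 (theta_q F (theta_q F y))
       + smult (B 3 * f * theta_log_coord F ^ 3) (theta_q F (theta_q F (theta_q F y)))"
proof -
  let ?g = "theta_log_coord F" and ?D = "theta_q F"
  have step: "theta_log (smult c z) = smult (theta c) z + smult (c * ?g) (?D z)" for c z
    by (simp add: theta_log_smult theta_log_eq_theta_q[of z F])
  define c1 where "c1 = f * ?g"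
  define d1 where "d1 = theta f * ?g + theta c1"
  define e1 where "e1 = theta (theta f) * ?g + theta d1"
  define c2 where "c2 = c1 * ?g"
  define d2 where "d2 = d1 * ?g + theta c2"
  have 1: "theta_log (smult f y) = smult (theta f) y + smult c1 (?D y)" for y
    by (simp add: step c1_def)
  have 2: "theta_log (theta_log (smult f y)) = smult (theta (theta f)) y + smult d1 (?D y) + smult c2 (?D (?D y))" for y
    unfolding 1 theta_log_add step by (simp add: c1_def d1_def c2_def smult_add_left)
  have 3: "theta_log (theta_log (theta_log (smult f y))) = smult (theta (theta (theta f))) y
      + smult e1 (?D y) + smult d2 (?D (?D y)) + smult (f * ?g ^ 3) (?D (?D (?D y)))" for y
    unfolding 2 theta_log_add step by (simp add: theta_add distrib_right d1_def e1_def d2_def c2_def c1_def smult_add_left power3_eq_cube mult.assoc)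
  show ?thesis
  proof (rule that[of "B 0 * f + B 1 * theta f + B 2 * theta (theta f) + B 3 * theta (theta (theta f))"
        "B 1 * c1 + B 2 * d1 + B 3 * e1" "B 2 * c2 + B 3 * d2"])
    fix y
    have "(\<Sum>i<4. smult (B i) ((theta_log ^^ i) (smult f y))) = smult (B 0) (smult f y)
      + smult (B 1) (theta_log (smult f y)) + smult (B 2) (theta_log (theta_log (smult f y)))
      + smult (B 3) (theta_log (theta_log (theta_log (smult f y))))"
      by (simp add: sum_less_4 eval_nat_numeral One_nat_def)
    then show "(\<Sum>i<4. smult (B i) ((theta_log ^^ i) (smult f y))) =
       smult (B 0 * f + B 1 * theta f + B 2 * theta (theta f) + B 3 * theta (theta (theta f))) y
       + smult (B 1 * c1 + B 2 * d1 + B 3 * e1) (?D y) + smult (B 2 * c2 + B 3 * d2) (?D (?D y))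
       + smult (B 3 * f * ?g ^ 3) (?D (?D (?D y)))"
      unfolding 3 unfolding 2 unfolding 1 by (simp add: smult_add_left smult_add_right mult.assoc)
  qed
qed

section \<open>The relation between K(q) and K(q^m)\<close>

lemma funpow_pderiv_monom:
  "(pderiv ^^ j) (monom (1 / fact i) i) = (if j \<le> i then monom (1 / fact (i - j)) (i - j) else (0 :: 'k::field_char_0 poly))"
proof (induction j)
  case (Suc j)
  show ?case
  proof (cases "Suc j \<le> i")
    case True
    then have "i - j = Suc (i - Suc j)" by simp
    then show ?thesis using Suc True
      by (simp add: One_nat_def pderiv_monom del: of_nat_Suc)
  next
    case False
    then show ?thesis using Suc
      by (cases "j = i") (simp_all add: pderiv_monom)
  qed
qed simp

lemma pcompose_monom_linear: "pcompose (monom c i) [:0, x:] = monom (c * x ^ i) i"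
  for c x :: "'k::field_char_0"
  by (induction i) (simp_all add: monom_0 monom_Suc pcompose_pCons smult_monom mult_ac)

text \<open>
  A solution is known from its part at the origin, where \<open>log t\<close> is replaced by \<open>m log t\<close> and the
  operator has the constant coefficients \<open>fps_nth (B j) 0\<close>.
\<close>
lemma frobenius_std_form:
  fixes F :: "nat \<Rightarrow> 'k::field_char_0 fps"
  assumes a0: "\<forall>i<4. fps_nth (a i) 0 = 0" and sb: "standard_basis a F" and m: "m > 0"
    and frob: "\<And>y. is_solution a y \<Longrightarrow>
      is_solution a (\<Sum>i<4. smult (B i) ((theta_log ^^ i) (log_subst (power_lift F m) y)))"
    and i: "i \<le> 3"
  shows "(\<Sum>j<4. smult (B j) ((theta_log ^^ j) (log_subst (power_lift F m) (std_form F i))))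
    = (\<Sum>j\<le>i. smult (fps_const (of_nat m ^ i * fps_nth (B j) 0)) (std_form F (i - j)))"
proof (rule solution_eqI[OF a0])
  have sol: "is_solution a (std_form F i)" if "i \<le> 3" for i
    using sb that by (simp add: standard_basis_def)
  show "is_solution a (\<Sum>j<4. smult (B j) ((theta_log ^^ j) (log_subst (power_lift F m) (std_form F i))))"
    by (rule frob[OF sol[OF i]])
  have zero: "is_solution a 0"
    using is_solution_smult_const[OF sol[of 0], of 0] by simp
  have sum: "is_solution a (sum y I)" if "\<And>j. j \<in> I \<Longrightarrow> is_solution a (y j)" for y and I :: "nat set"
    using that by (induction I rule: infinite_finite_induct) (auto simp: zero is_solution_add)
  show "is_solution a (\<Sum>j\<le>i. smult (fps_const (of_nat m ^ i * fps_nth (B j) 0)) (std_form F (i - j)))"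
    using i by (intro sum is_solution_smult_const sol) simp_all
  have F: "fps_nth (F 1) 0 = 0" "fps_nth (F 0) 0 = 1"
    using sb by (simp_all add: standard_basis_def)
  obtain h where h: "fps_nth h 0 = 0" "power_lift F m = fps_X ^ m * (fps_exp 1 oo h)"
    using power_lift_props[OF F m] by metis
  have "log_part 0 (log_subst (power_lift F m) (std_form F i)) = smult (of_nat m ^ i) (monom (1 / fact i) i)"
    using log_part_0_log_subst[OF h(1) log_series_X_power_exp[OF h(1), of m, folded h(2)]]
    by (simp add: log_part_0_std_form[OF sb i] pcompose_monom_linear smult_monom)
  moreover have "(pderiv ^^ j) (smult c y) = smult c ((pderiv ^^ j) y)" for j c and y :: "'k poly"
    by (induction j) (simp_all add: pderiv_smult)
  moreover have lsum: "log_part 0 (sum y I) = (\<Sum>i\<in>I. log_part 0 (y i))" for y :: "nat \<Rightarrow> 'k fps poly" and I :: "nat set"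
    by (induction I rule: infinite_finite_induct) (simp_all add: log_part_add)
  ultimately have "log_part 0 (\<Sum>j<4. smult (B j) ((theta_log ^^ j) (log_subst (power_lift F m) (std_form F i))))
     = (\<Sum>j<4. if j \<le> i then smult (of_nat m ^ i * fps_nth (B j) 0) (monom (1 / fact (i - j)) (i - j)) else 0)"
    by (auto simp: log_part_0_smult log_part_0_funpow_theta_log funpow_pderiv_monom intro!: sum.cong)
  also have "\<dots> = (\<Sum>j\<le>i. smult (of_nat m ^ i * fps_nth (B j) 0) (monom (1 / fact (i - j)) (i - j)))"
    using i by (intro sum.mono_neutral_cong_right) auto
  also have "\<dots> = log_part 0 (\<Sum>j\<le>i. smult (fps_const (of_nat m ^ i * fps_nth (B j) 0)) (std_form F (i - j)))"
    using i by (simp add: lsum log_part_0_smult log_part_0_std_form[OF sb])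
  finally show "log_part 0 (\<Sum>j<4. smult (B j) ((theta_log ^^ j) (log_subst (power_lift F m) (std_form F i)))) = \<dots>" .
qed

lemma std_form_0: "std_form F 0 = [:F 0:]"
  by (simp add: std_form_def monom_0)

lemma std_form_1:
  assumes "fps_nth (F 0) 0 = 1"
  shows "std_form F 1 = smult (F 0) (log_q F)"
proof -
  have "F 0 * (F 1 / F 0) = F 1"
    using assms by (simp add: fps_divide_unit inverse_mult_eq_1 mult.left_commute[of "F 0"] mult.commute[of "F 0" "inverse (F 0)"])
  then show ?thesis
    by (simp add: std_form_def One_nat_def monom_0 monom_Suc log_q_def)
qed

text \<open>
  Completing the square in \<open>log t\<close>: \<open>U = log^2 q / 2 + V\<close> with a power series \<open>V\<close>.
\<close>
lemma y2_over_y0_eq: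
  fixes F :: "nat \<Rightarrow> 'k::field_char_0 fps"
  assumes "fps_nth (F 0) 0 = 1"
  obtains V where "2 * y2_over_y0 F = log_q F ^ 2 + [:V:]"
proof
  have i: "inverse (F 0) * F 0 = 1"
    using assms by (simp add: inverse_mult_eq_1)
  have h: "2 * fps_const (1 / 2 :: 'k) = 1"
    by (simp add: fps_numeral_fps_const)
  have d: "F 1 / F 0 = inverse (F 0) * F 1"
    using assms by (simp add: fps_divide_unit)
  have "2 * (inverse (F 0) * (fps_const (1/2) * F 0)) = (2 * fps_const (1/2)) * (inverse (F 0) * F 0)"
    by (simp only: mult_ac)
  then have 2: "2 * (inverse (F 0) * (fps_const (1/2) * F 0)) = 1"
    by (simp only: h i mult_1)
  have "std_form F 2 = [:F 2, F 1, fps_const (1/2) * F 0:]"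
    by (simp add: std_form_def One_nat_def eval_nat_numeral monom_0 monom_Suc)
  then show "2 * y2_over_y0 F = log_q F ^ 2 + [:2 * inverse (F 0) * F 2 - (inverse (F 0) * F 1) ^ 2:]"
    using 2 by (simp add: y2_over_y0_def log_q_def d numeral_poly power2_eq_square mult_ac)
qed

lemma theta_q_numeral: "theta_q F (numeral k * y) = numeral k * theta_q F y"
proof -
  have "theta (numeral k) = (0 :: 'a fps)"
    by (simp add: fps_numeral_fps_const)
  then show ?thesis
    by (simp add: scaled_theta_def theta_log_smult numeral_poly mult.commute)
qed

lemma theta_q_numeral_0: "theta_q F (numeral k) = 0"
  using theta_q_numeral[of F k 1] by (simp add: one_pCons scaled_theta_const)

lemma theta_q_theta_q_y2_over_y0_const:
  fixes F :: "nat \<Rightarrow> 'k::field_char_0 fps"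
  assumes F: "fps_nth (F 0) 0 = 1"
  obtains \<kappa> where "theta_q F (theta_q F (y2_over_y0 F)) = [:\<kappa>:]"
proof -
  obtain V where "2 * y2_over_y0 F = log_q F ^ 2 + [:V:]"
    using y2_over_y0_eq[where F = F, OF F] .
  then have "theta_q F (theta_q F (2 * y2_over_y0 F)) = theta_q F (theta_q F (log_q F ^ 2 + [:V:]))"
    by simp
  then obtain W where "2 * theta_q F (theta_q F (y2_over_y0 F)) = 2 + [:W:]"
    by (simp add: theta_q_numeral theta_q_numeral_0 scaled_theta_add scaled_theta_mult power2_eq_square
        scaled_theta_const)
  then have W: "2 * theta_q F (theta_q F (y2_over_y0 F)) = [:2 + W:]"
    by (simp add: numeral_poly)
  have "theta_q F (theta_q F (y2_over_y0 F))
      = smult (fps_const (1/2)) (2 * theta_q F (theta_q F (y2_over_y0 F)))"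
    by (simp add: numeral_poly fps_numeral_fps_const)
  then show ?thesis
    using that W by simp
qed

text \<open>
  Let \<open>l = log q\<close>, \<open>U = y_2 / y_0\<close>, \<open>W = y_3 / y_0\<close>, \<open>D = \<theta>_q\<close>, and let
  \<open>\<sigma>\<close> be the substitution, for which \<open>\<sigma> l = m l\<close> and \<open>D \<sigma> = m \<sigma> D\<close>. Conjugating the Frobenius
  operator by \<open>y_0\<close> gives \<open>C0 + C1 D + C2 D^2 + c D^3\<close>, whose value on \<open>\<sigma> 1, \<sigma> l, \<sigma> U, \<sigma> W\<close>
  is known. The first two values force \<open>C0 = F 0\<close>, which is the formula for \<open>F 0\<close>, and \<open>C1 = 0\<close>,
  because the Frobenius constant with index 1 vanishes. Eliminating the unknown \<open>C2\<close> from the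
  other two leaves an equation for \<open>Z = W - l U\<close> in which \<open>c\<close> multiplies \<open>\<sigma> (D^2 U)\<close>. By
  self-duality \<open>D Z = - 2 U\<close>, so applying \<open>D^3\<close> yields an equation for \<open>\<kappa> = D^2 U\<close>, which is
  \<open>K\<close> in the coordinate \<open>t\<close>.
\<close>
theorem frobenius_relation:
  fixes F :: "nat \<Rightarrow> 'k::field_char_0 fps"
  assumes a0: "\<forall>i<4. fps_nth (a i) 0 = 0" and sb: "standard_basis a F" and sd: "self_dual a" and m: "m > 0"
    and frob: "\<And>y. is_solution a y \<Longrightarrow>
      is_solution a (\<Sum>i<4. smult (B i) ((theta_log ^^ i) (log_subst (power_lift F m) y)))"
    and B0: "fps_nth (B 0) 0 = 1" and B1: "fps_nth (B 1) 0 = 0"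
    and K: "[:K:] = theta_log (theta_log (y2_over_y0_in_q F))"
  defines "b \<equiv> B 3 * (F 0 oo power_lift F m) * theta_log_coord F ^ 3 * inverse (F 0)"
  shows "F 0 = (\<Sum>i<4. B i * (theta ^^ i) (F 0 oo power_lift F m))"
    and "2 * (K - (K oo fps_X ^ m)) = - theta (theta (theta ((b oo t_of_q F) * (K oo fps_X ^ m))))"
proof -
  have F: "fps_nth (F 1) 0 = 0" "fps_nth (F 0) 0 = 1"
    using sb by (simp_all add: standard_basis_def)
  have inv: "inverse (F 0) * F 0 = 1" "F 0 * inverse (F 0) = 1"
    using inverse_mult_eq_1[of "F 0"] F by (simp_all add: mult.commute)
  define s where "s = power_lift F m"
  define \<sigma> where "\<sigma> = log_subst s"
  define D where "D = theta_q F"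
  define l where "l = log_q F"
  define U where "U = y2_over_y0 F"
  define W where "W = smult (inverse (F 0)) (std_form F 3)"
  obtain h where h: "fps_nth h 0 = 0" "s = fps_X ^ m * (fps_exp 1 oo h)"
    "\<sigma> l = of_nat m * l" and D\<sigma>: "\<And>y. D (\<sigma> y) = of_nat m * \<sigma> (D y)"
    using power_lift_props[OF F m] unfolding s_def \<sigma>_def l_def D_def by metis
  have s0: "fps_nth s 0 = 0"
    using m by (simp add: h)
  obtain \<kappa> where \<kappa>: "D (D U) = [:\<kappa>:]"
    using theta_q_theta_q_y2_over_y0_const[where F = F, OF F(2)] unfolding D_def U_def by metis
  note D_add = scaled_theta_add[of "inverse (theta_log_coord F)", folded D_def]
  note D_diff = scaled_theta_diff[of "inverse (theta_log_coord F)", folded D_def]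
  note D_mult = scaled_theta_mult[of "inverse (theta_log_coord F)", folded D_def]
  note D_const = scaled_theta_const[of "inverse (theta_log_coord F)", folded D_def]
  note \<sigma>_add = log_subst_add[of s, folded \<sigma>_def]
  note \<sigma>_diff = log_subst_diff[of s, folded \<sigma>_def]
  note \<sigma>_mult = log_subst_mult[OF s0, folded \<sigma>_def]
  have Dl: "D l = 1" by (simp add: D_def l_def)
  have Dn: "D (of_nat n) = 0" for n
    by (simp add: of_nat_poly D_const)
  have D1: "D 1 = 0" by (simp add: one_pCons D_const)
  have D_nmult: "D (of_nat n * y) = of_nat n * D y" for n y
    by (simp add: D_mult Dn)
  have y: "std_form F 0 = smult (F 0) 1" "std_form F 1 = smult (F 0) l" "std_form F 2 = smult (F 0) U"
     "std_form F 3 = smult (F 0) W"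
    using std_form_1[where F = F, OF F(2)] inv by (simp_all add: std_form_0 l_def U_def y2_over_y0_def W_def one_pCons)

  \<comment> \<open>The pairing relation divided by \<open>y_0 ^ 2\<close>, where the terms with \<open>\<theta> y_0\<close> cancel.\<close>
  have DW: "D W = l * D U - U"
  proof -
    have t: "theta_log (smult (F 0) y) = smult (theta (F 0)) y + smult (F 0 * theta_log_coord F) (D y)" for y
      unfolding D_def by (simp add: theta_log_smult theta_log_eq_theta_q[of y F])
    have "smult (F 0 * (F 0 * theta_log_coord F)) (D W) = smult (F 0 * (F 0 * theta_log_coord F)) (l * D U - U)"
      using self_dual_pairing[OF a0 sb sd] unfolding y t
      by (simp add: D1 Dl algebra_simps smult_add_right smult_diff_right)
    moreover have "F 0 * (F 0 * theta_log_coord F) \<noteq> 0"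
    proof -
      have "fps_nth (F 0 * (F 0 * theta_log_coord F)) 0 = 1" by (simp add: F)
      then show ?thesis by (metis fps_zero_nth zero_neq_one)
    qed
    moreover have "y = z" if "smult c y = smult c z" "c \<noteq> 0" for c and y z :: "'k fps poly"
      using that smult_eq_0_iff[of c "y - z"] by (simp add: smult_diff_right)
    ultimately show ?thesis by metis
  qed
  have DDW: "D (D W) = l * [:\<kappa>:]"
    by (simp add: DW D_diff D_mult Dl \<kappa>)
  define f where "f = F 0 oo s"
  define op where "op y = (\<Sum>i<4. smult (B i) ((theta_log ^^ i) y))" for y
  define c where "c = B 3 * f * theta_log_coord F ^ 3"
  obtain C0 C1 C2 where op: "\<And>y. op (smult f y) =
       smult C0 y + smult C1 (D y) + smult C2 (D (D y)) + smult c (D (D (D y)))"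
    unfolding op_def D_def c_def by (rule leibniz_theta_q[of B f F]) blast
  have \<sigma>_smult: "\<sigma> (smult (F 0) y) = smult f (\<sigma> y)" for y
    by (simp add: \<sigma>_def f_def log_subst_smult s0)
  have \<sigma>1: "\<sigma> 1 = 1" by (simp add: \<sigma>_def)
  define \<alpha> where "\<alpha> j = [:fps_const (fps_nth (B j) 0):]" for j
  have \<alpha>: "\<alpha> 0 = 1" "\<alpha> 1 = 0"
    by (simp_all add: \<alpha>_def B0 B1 one_pCons)
  have Dal: "D (\<alpha> j) = 0" for j by (simp add: \<alpha>_def D_const)
  have Y: "op (\<sigma> (std_form F i)) = (\<Sum>j\<le>i. of_nat m ^ i * \<alpha> j * std_form F (i - j))" if "i \<le> 3" for i
  proof -
    have "of_nat m ^ i * \<alpha> j * z = smult (fps_const (of_nat m ^ i * fps_nth (B j) 0)) z" for i j z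
      by (simp add: \<alpha>_def of_nat_poly poly_const_pow)
         (simp only: fps_const_mult[symmetric] fps_const_power[symmetric] fps_of_nat mult.commute)
    then show ?thesis
      using frobenius_std_form[OF a0 sb m frob that] unfolding op_def s_def \<sigma>_def by simp
  qed
  let ?F = "[:F 0:]"
  have D0: "D 0 = 0" using D_diff[of 0 0] by simp
  have upto: "{..1::nat} = {0, 1}" "{..2::nat} = {0, 1, 2}" "{..3::nat} = {0, 1, 2, 3}" by auto
  have m0: "(of_nat m :: 'k fps poly) \<noteq> 0"
    using m by (simp add: of_nat_poly flip: fps_of_nat)
  have Y0: "op (smult f 1) = smult (F 0) 1"
    using Y[of 0] unfolding y \<sigma>_smult \<sigma>1 by (simp add: \<alpha> y)
  have E0: "[:C0:] = ?F"
    using Y0 unfolding op by (simp add: D1 D0)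
  have E1: "[:C0:] * (of_nat m * l) + [:C1:] * of_nat m = of_nat m * (?F * l)"
    using Y[of 1] by (simp add: upto y \<alpha> \<sigma>_smult op h(3) D_nmult Dl D1 Dn D0)
  have "[:C1:] * of_nat m = 0"
    using E1 unfolding E0 by (simp add: algebra_simps)
  then have C1: "C1 = 0" using m0 by simp
  have s\<kappa>: "\<sigma> [:\<kappa>:] = [:\<kappa> oo s:]" by (simp add: \<sigma>_def)
  have E2: "?F * \<sigma> U + [:C2:] * (of_nat m ^ 2 * \<sigma> [:\<kappa>:]) + [:c:] * (of_nat m ^ 3 * \<sigma> (D [:\<kappa>:]))
     = of_nat m ^ 2 * (?F * (U + \<alpha> 2))"
    using Y[of 2] E0
    by (simp add: upto y \<alpha> \<sigma>_smult op C1 D\<sigma> D_nmult \<kappa> power2_eq_square power3_eq_cube algebra_simps)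
  have E3: "?F * \<sigma> W + [:C2:] * (of_nat m ^ 2 * \<sigma> (l * [:\<kappa>:])) + [:c:] * (of_nat m ^ 3 * \<sigma> (D (l * [:\<kappa>:])))
     = of_nat m ^ 3 * (?F * (W + \<alpha> 2 * l + \<alpha> 3))"
    using Y[of 3] E0
    by (simp add: upto y y(2)[unfolded One_nat_def] \<alpha> \<sigma>_smult op C1 D\<sigma> D_nmult DDW power2_eq_square power3_eq_cube algebra_simps)
  define Z where "Z = W - l * U"
  \<comment> \<open>Subtracting \<open>m l\<close> times \<open>E2\<close> from \<open>E3\<close> cancels \<open>C2\<close>, \<open>\<sigma> (D \<kappa>)\<close> and the constant \<open>\<alpha> 2\<close>.\<close>
  have EZ: "?F * (\<sigma> Z - of_nat m ^ 3 * Z - of_nat m ^ 3 * \<alpha> 3) + [:c:] * (of_nat m ^ 3 * \<sigma> [:\<kappa>:]) = 0"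
  proof -
    let ?m = "of_nat m :: 'k fps poly"
    have "?F * (\<sigma> Z - ?m ^ 3 * Z - ?m ^ 3 * \<alpha> 3) + [:c:] * (?m ^ 3 * \<sigma> [:\<kappa>:])
      = (?F * \<sigma> W + [:C2:] * (?m ^ 2 * \<sigma> (l * [:\<kappa>:])) + [:c:] * (?m ^ 3 * \<sigma> (D (l * [:\<kappa>:])))
          - ?m ^ 3 * (?F * (W + \<alpha> 2 * l + \<alpha> 3)))
        - ?m * l * (?F * \<sigma> U + [:C2:] * (?m ^ 2 * \<sigma> [:\<kappa>:]) + [:c:] * (?m ^ 3 * \<sigma> (D [:\<kappa>:]))
          - ?m ^ 2 * (?F * (U + \<alpha> 2)))"
      unfolding Z_def D_mult Dl \<sigma>_mult \<sigma>_diff \<sigma>_add h(3) \<sigma>1 power2_eq_square power3_eq_cube mult_1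
      by (simp only: algebra_simps)
    then show ?thesis unfolding E2 E3 by simp
  qed
  have comb: "x + z * [:b * (\<kappa> oo s):] = [:inverse (F 0):] * (?F * x + [:c:] * (z * \<sigma> [:\<kappa>:]))" for x z
    using inv by (simp add: s\<kappa> b_def c_def f_def s_def smult_add_right mult_ac)
  have rel: "\<sigma> Z - of_nat m ^ 3 * Z - of_nat m ^ 3 * \<alpha> 3 + of_nat m ^ 3 * [:b * (\<kappa> oo s):] = 0"
    unfolding comb EZ by simp
  have DZ: "D Z = - (2 * U)"
    by (simp add: Z_def D_diff DW D_mult Dl)
  have D_minus2: "D (- (2 * y)) = - (2 * D y)" for y
    using D_diff[of 0 "2 * y"] D_add[of y y] D_diff[of 0 0] by simp
  have \<sigma>_minus2: "\<sigma> (- (2 * y)) = - (2 * \<sigma> y)" for y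
    using \<sigma>_diff[of 0 "2 * y"] \<sigma>_add[of y y] by (simp add: \<sigma>_def)
  have Dp: "D (of_nat m ^ 3 * y) = of_nat m ^ 3 * D y" for y
    using D_nmult[of "m ^ 3"] by simp
  let ?R = "[:b * (\<kappa> oo s):]"
  \<comment> \<open>The constant \<open>\<alpha> 3\<close> disappears under \<open>D\<close>, and every term acquires the same factor \<open>m ^ 3\<close>.\<close>
  have "D (D (D (\<sigma> Z - of_nat m ^ 3 * Z - of_nat m ^ 3 * \<alpha> 3 + of_nat m ^ 3 * ?R))) = 0"
    unfolding rel D0 ..
  then have "of_nat m ^ 3 * (2 * ([:\<kappa>:] - \<sigma> [:\<kappa>:]) + D (D (D ?R))) = 0"
    unfolding D_diff D_add Dp Dal D\<sigma> D_nmult DZ D_minus2 \<sigma>_minus2 \<kappa>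
    by (simp add: power3_eq_cube algebra_simps D0)
  then have "2 * ([:\<kappa>:] - \<sigma> [:\<kappa>:]) + D (D (D ?R)) = 0"
    using m0 by (simp only: mult_eq_0_iff power_eq_0_iff simp_thms)
  then have rel2: "D (D (D ?R)) = 2 * ([:\<kappa> oo s:] - [:\<kappa>:])"
    unfolding s\<kappa> by (metis add_eq_0_iff minus_diff_eq mult_minus_right)
  \<comment> \<open>In the coordinate \<open>q\<close> the derivation \<open>D\<close> becomes \<open>q d/dq\<close>, and \<open>\<sigma>\<close> becomes \<open>q \<mapsto> q ^ m\<close>.\<close>
  define \<tau> where "\<tau> = t_of_q F"
  have \<tau>0: "fps_nth \<tau> 0 = 0" by (simp add: \<tau>_def t_of_q_nth_0)
  have th\<tau>: "theta_log (log_subst \<tau> y) = log_subst \<tau> (D y)" for y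
    unfolding \<tau>_def D_def by (rule theta_log_log_subst_t_of_q[OF F])
  have K\<kappa>: "K = \<kappa> oo \<tau>"
    using K unfolding y2_over_y0_in_q_def \<tau>_def[symmetric] U_def[symmetric] th\<tau> \<kappa> by simp
  have "\<kappa> oo s oo \<tau> = K oo fps_X ^ m"
  proof -
    have "s oo \<tau> = \<tau> oo fps_X ^ m"
    proof -
      have "canonical_coord F ^ m oo \<tau> = fps_X ^ m"
        using fps_compose_power[OF \<tau>0, of "canonical_coord F" m] canonical_coord_t_of_q[of F] by (simp add: \<tau>_def)
      then show ?thesis
        using m unfolding s_def power_lift_def \<tau>_def[symmetric]
        by (simp add: canonical_coord_nth \<tau>0 flip: fps_compose_assoc)
    qed
    then show ?thesis
      using m by (simp add: K\<kappa> \<tau>0 s0 flip: fps_compose_assoc)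
  qed
  then have "theta_log (theta_log (theta_log (log_subst \<tau> ?R))) = [:2 * ((K oo fps_X ^ m) - K):]"
    unfolding th\<tau> rel2
    by (simp add: numeral_poly K\<kappa> fps_compose_sub_distrib fps_compose_mult_distrib log_subst_smult \<tau>0 algebra_simps)
  then have "theta (theta (theta (b * (\<kappa> oo s) oo \<tau>))) = 2 * ((K oo fps_X ^ m) - K)"
    by simp
  then show "2 * (K - (K oo fps_X ^ m)) = - theta (theta (theta ((b oo t_of_q F) * (K oo fps_X ^ m))))"
    using \<open>\<kappa> oo s oo \<tau> = K oo fps_X ^ m\<close>
    by (simp add: fps_compose_mult_distrib \<tau>0 flip: \<tau>_def)
  have "(theta_log ^^ i) [:g:] = [:(theta ^^ i) g:]" for i and g :: "'k fps"
    by (induction i) simp_all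
  then have "op (smult f 1) = [:\<Sum>i<4. B i * (theta ^^ i) f:]"
    by (simp add: op_def sum_less_4)
  then show "F 0 = (\<Sum>i<4. B i * (theta ^^ i) (F 0 oo power_lift F m))"
    using Y0 by (simp add: f_def s_def)
qed

section \<open>Integrality over the p-adic integers\<close>

lemma
  shows Zp_0 [simp]: "0 \<in> Zp" and Zp_1 [simp]: "1 \<in> Zp"
  and Zp_add: "x \<in> Zp \<Longrightarrow> y \<in> Zp \<Longrightarrow> x + y \<in> Zp"
  and Zp_uminus: "x \<in> Zp \<Longrightarrow> - x \<in> Zp"
  and Zp_mult: "x \<in> Zp \<Longrightarrow> y \<in> Zp \<Longrightarrow> x * y \<in> Zp"
proof -
  show "0 \<in> Zp" "1 \<in> Zp"
    unfolding Zp_def Zero_fract_def One_fract_def by (rule rangeI)+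
  show "- x \<in> Zp" if "x \<in> Zp" using that
    by (auto simp: Zp_def)
  show "x + y \<in> Zp" "x * y \<in> Zp" if "x \<in> Zp" "y \<in> Zp" using that
    by (auto simp: Zp_def)
qed

lemma Zp_diff: "x \<in> Zp \<Longrightarrow> y \<in> Zp \<Longrightarrow> x - y \<in> Zp"
  using Zp_add[of x "- y"] Zp_uminus[of y] by simp

lemma Zp_sum: "(\<And>i. i \<in> I \<Longrightarrow> f i \<in> Zp) \<Longrightarrow> sum f I \<in> Zp"
  by (induction I rule: infinite_finite_induct) (simp_all add: Zp_add)

lemma Zp_power: "x \<in> Zp \<Longrightarrow> x ^ n \<in> Zp"
  by (induction n) (simp_all add: Zp_mult)

lemma Zp_of_nat: "of_nat n \<in> Zp"
  by (induction n) (simp_all add: Zp_add)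

text \<open>
  The inverses modulo the powers of \<open>p\<close> are unique, hence compatible.
\<close>
lemma padic_int_of_nat_invertible:
  assumes "coprime n CARD('p::prime_card)"
  obtains x :: "'p::prime_card padic_int" where "of_nat n * x = 1"
proof -
  let ?p = "int CARD('p)"
  have cop: "coprime (int n) (?p ^ k)" for k
    using assms by (simp flip: of_nat_power)
  have "\<exists>y. \<forall>k. [int n * y k = 1] (mod ?p ^ k)"
    using cong_solve_coprime_int[OF cop] by metis
  then obtain y where y: "[int n * y k = 1] (mod ?p ^ k)" for k
    by blast
  have compat: "\<forall>k. (y (Suc k) mod ?p ^ Suc k) mod ?p ^ k = y k mod ?p ^ k"
  proof
    fix k
    have "[int n * y (Suc k) = 1] (mod ?p ^ k)"
      using y[of "Suc k"] by (rule cong_dvd_modulus) simp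
    then have "[int n * y (Suc k) = int n * y k] (mod ?p ^ k)"
      using y[of k] by (metis cong_sym cong_trans)
    then have "[y (Suc k) = y k] (mod ?p ^ k)"
      using cop[of k] by (simp add: cong_mult_lcancel)
    then show "(y (Suc k) mod ?p ^ Suc k) mod ?p ^ k = y k mod ?p ^ k"
      unfolding padic_reduce by (simp add: cong_def)
  qed
  define x :: "'p padic_int" where "x = Abs_padic_int (\<lambda>k. y k mod ?p ^ k)"
  have x: "Rep_padic_int x k = y k mod ?p ^ k" for k
    unfolding x_def using compat by (subst Abs_padic_int_inverse) auto
  have "Rep_padic_int (of_nat n * x) k = Rep_padic_int (1 :: 'p padic_int) k" for k
    using y[of k] by (simp add: times_padic_int.rep_eq one_padic_int.rep_eq of_nat_padic_int x mod_simps cong_def)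
  then have "of_nat n * x = 1"
    by (metis Rep_padic_int_inject ext)
  then show ?thesis by (rule that)
qed

lemma Zp_inverse_of_nat:
  assumes "coprime n CARD('p::prime_card)"
  shows "inverse (of_nat n) \<in> (Zp :: 'p::prime_card padic set)"
proof -
  obtain x :: "'p padic_int" where "of_nat n * x = 1"
    using padic_int_of_nat_invertible[OF assms] .
  then have "(of_nat n :: 'p padic) * Fract x 1 = 1"
    by (simp add: of_nat_fract One_fract_def)
  then have "inverse (of_nat n) = Fract x 1"
    by (metis inverse_unique)
  then show ?thesis by (simp add: Zp_def)
qed

text \<open>
  Integrality of the coefficients below \<open>t ^ N\<close>. It serves to prove integrality of a series by
  induction from a functional equation whose right-hand side uses fewer coefficients than the
  left-hand side determines.
\<close>
definition Zp_upto :: "nat \<Rightarrow> 'p::prime_card padic fps set" where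
  "Zp_upto N = {f. \<forall>n<N. fps_nth f n \<in> Zp}"

lemma Zp_upto_0 [simp]: "f \<in> Zp_upto 0"
  by (simp add: Zp_upto_def)

lemma Zp_fps_iff_upto: "f \<in> Zp_fps \<longleftrightarrow> (\<forall>N. f \<in> Zp_upto N)"
  by (auto simp: Zp_fps_def Zp_upto_def)

lemma Zp_fps_upto: "f \<in> Zp_fps \<Longrightarrow> f \<in> Zp_upto N"
  by (simp add: Zp_fps_iff_upto)

lemma Zp_fps_contraction:
  assumes "\<And>N. f \<in> Zp_upto N \<Longrightarrow> f \<in> Zp_upto (Suc N)"
  shows "f \<in> Zp_fps"
proof -
  have "f \<in> Zp_upto N" for N
    by (induction N) (simp_all add: assms)
  then show ?thesis by (simp add: Zp_fps_iff_upto)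
qed

lemma Zp_upto_add: "f \<in> Zp_upto N \<Longrightarrow> g \<in> Zp_upto N \<Longrightarrow> f + g \<in> Zp_upto N"
  and Zp_upto_diff: "f \<in> Zp_upto N \<Longrightarrow> g \<in> Zp_upto N \<Longrightarrow> f - g \<in> Zp_upto N"
  and Zp_upto_theta: "f \<in> Zp_upto N \<Longrightarrow> theta f \<in> Zp_upto N"
  by (auto simp: Zp_upto_def Zp_add Zp_diff Zp_mult Zp_of_nat)

lemma Zp_upto_mult: "f \<in> Zp_upto N \<Longrightarrow> g \<in> Zp_upto N \<Longrightarrow> f * g \<in> Zp_upto N"
  by (auto simp: Zp_upto_def fps_mult_nth intro!: Zp_sum Zp_mult)

lemma Zp_upto_sum: "(\<And>i. i \<in> I \<Longrightarrow> f i \<in> Zp_upto N) \<Longrightarrow> sum f I \<in> Zp_upto N"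
  by (auto simp: Zp_upto_def fps_sum_nth intro!: Zp_sum)

lemma Zp_upto_mult_Suc:
  assumes "f \<in> Zp_upto N" "c \<in> Zp_fps" "fps_nth c 0 = 0"
  shows "c * f \<in> Zp_upto (Suc N)"
  unfolding Zp_upto_def
proof safe
  fix n assume "n < Suc N"
  then have "fps_nth c i * fps_nth f (n - i) \<in> Zp" if "i \<le> n" for i
    using assms that by (cases i) (auto simp: Zp_upto_def Zp_fps_def intro!: Zp_mult)
  then show "fps_nth (c * f) n \<in> Zp"
    by (auto simp: fps_mult_nth intro!: Zp_sum)
qed

lemma Zp_fps_add: "f \<in> Zp_fps \<Longrightarrow> g \<in> Zp_fps \<Longrightarrow> f + g \<in> Zp_fps"
  and Zp_fps_theta: "f \<in> Zp_fps \<Longrightarrow> theta f \<in> Zp_fps"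
  and Zp_fps_diff: "f \<in> Zp_fps \<Longrightarrow> g \<in> Zp_fps \<Longrightarrow> f - g \<in> Zp_fps"
  and Zp_fps_mult: "f \<in> Zp_fps \<Longrightarrow> g \<in> Zp_fps \<Longrightarrow> f * g \<in> Zp_fps"
  by (simp_all add: Zp_fps_iff_upto Zp_upto_add Zp_upto_theta Zp_upto_mult Zp_upto_diff)

lemma Zp_fps_const: "c \<in> Zp \<Longrightarrow> fps_const c \<in> Zp_fps"
  by (simp add: Zp_fps_def)

lemma Zp_fps_1 [simp]: "1 \<in> Zp_fps" and Zp_fps_X [simp]: "fps_X \<in> Zp_fps"
  by (simp_all add: Zp_fps_def fps_X_def)

lemma Zp_fps_power: "f \<in> Zp_fps \<Longrightarrow> f ^ n \<in> Zp_fps"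
  by (induction n) (simp_all add: Zp_fps_mult)

lemma Zp_upto_compose:
  assumes "f \<in> Zp_upto N" "s \<in> Zp_fps"
  shows "f oo s \<in> Zp_upto N"
  using assms(1) Zp_fps_power[OF assms(2)]
  by (auto simp: Zp_upto_def Zp_fps_def fps_compose_nth intro!: Zp_sum Zp_mult)

lemma Zp_fps_compose: "f \<in> Zp_fps \<Longrightarrow> s \<in> Zp_fps \<Longrightarrow> f oo s \<in> Zp_fps"
  by (simp add: Zp_fps_iff_upto[of f] Zp_fps_iff_upto[of "f oo s"] Zp_upto_compose)

text \<open>
  Substituting a series divisible by \<open>t^2\<close> contracts: the coefficient of \<open>t ^ N\<close> in the composition
  uses \<open>f\<close> only below \<open>N\<close>.
\<close>
lemma Zp_upto_compose_Suc:
  assumes f: "f \<in> Zp_upto N" and N: "N > 0" and s: "fps_X * s \<in> Zp_fps" "fps_nth s 0 = 0"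
  shows "f oo (fps_X * s) \<in> Zp_upto (Suc N)"
proof -
  have "fps_nth ((fps_X * s) ^ N) N = 0"
    using s N by (simp add: power_mult_distrib fps_X_power_mult_nth)
  then have "fps_nth f i * fps_nth ((fps_X * s) ^ i) n \<in> Zp" if "n < Suc N" "i \<le> n" for i n
    using f Zp_fps_power[OF s(1), of i] that
    by (cases "i = N"; cases "n = N") (auto simp: Zp_upto_def Zp_fps_def intro!: Zp_mult)
  then show ?thesis
    by (auto simp: Zp_upto_def fps_compose_nth intro!: Zp_sum)
qed

lemma Zp_fps_inverse:
  assumes f: "f \<in> Zp_fps" "fps_nth f 0 = 1"
  shows "inverse f \<in> Zp_fps"
proof (rule Zp_fps_contraction)
  fix N assume N: "inverse f \<in> Zp_upto N"
  have "inverse f * f = 1" using f by (simp add: inverse_mult_eq_1)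
  then have "inverse f = 1 - (f - 1) * inverse f"
    by (simp add: algebra_simps)
  also have "\<dots> \<in> Zp_upto (Suc N)"
    using N f by (intro Zp_upto_diff Zp_upto_mult_Suc) (simp_all add: Zp_fps_upto Zp_fps_diff)
  finally show "inverse f \<in> Zp_upto (Suc N)" .
qed

text \<open>
  With leading coefficient 1, the recursion for the compositional inverse needs no division.
\<close>
lemma Zp_fps_inv:
  assumes f: "f \<in> Zp_fps" "fps_nth f 1 = 1"
  shows "fps_inv f \<in> Zp_fps"
proof -
  have X: "fps_nth fps_X n \<in> Zp" for n by (simp add: fps_X_def)
  have "compinv f n \<in> Zp" for n
  proof (induction n rule: less_induct)
    case (less n)
    show ?case
    proof (cases n)
      case 0
      then show ?thesis using X[of 0] by (simp del: fps_X_nth)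
    next
      case (Suc k)
      have "compinv f i * fps_nth (f ^ i) n \<in> Zp" if "i \<le> k" for i
        using less Suc that Zp_fps_power[OF f(1), of i] by (auto simp: Zp_fps_def intro!: Zp_mult)
      then have "fps_nth fps_X n - (\<Sum>i=0..k. compinv f i * fps_nth (f ^ i) n) \<in> Zp"
        by (intro Zp_diff X Zp_sum) auto
      then show ?thesis using f(2) Suc by simp
    qed
  qed
  then show ?thesis by (simp add: Zp_fps_def fps_inv_def)
qed

section \<open>Lambert series and supercongruences\<close>

lemma lambert_term_nth:
  assumes "r > 0"
  shows "fps_nth (fps_const c * fps_X ^ r / (1 - fps_X ^ r) :: 'k::field fps) n
    = (if n > 0 \<and> r dvd n then c else 0)"
proof -
  define G :: "'k fps" where "G = Abs_fps (\<lambda>n. if n > 0 \<and> r dvd n then c else 0)"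
  have "G * (1 - fps_X ^ r) = fps_const c * fps_X ^ r"
  proof (rule fps_ext)
    fix n
    have "fps_nth (G * (1 - fps_X ^ r)) n = fps_nth G n - (if n < r then 0 else fps_nth G (n - r))"
      by (simp add: right_diff_distrib fps_X_power_mult_right_nth)
    also have "\<dots> = fps_nth (fps_const c * fps_X ^ r) n"
      using assms by (auto simp: G_def dvd_minus_self not_less dest: dvd_imp_le)
    finally show "fps_nth (G * (1 - fps_X ^ r)) n = fps_nth (fps_const c * fps_X ^ r) n" .
  qed
  moreover have "fps_nth (1 - fps_X ^ r :: 'k fps) 0 = 1"
    using assms by simp
  then have "(1 - fps_X ^ r :: 'k fps) \<noteq> 0"
    by (metis fps_zero_nth zero_neq_one)
  ultimately have "fps_const c * fps_X ^ r / (1 - fps_X ^ r) = G"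
    by (metis nonzero_mult_div_cancel_right)
  then show ?thesis by (simp add: G_def)
qed

text \<open>
  Convergence of power series is eventual constancy of each coefficient, so a coefficient of the
  sum is a finite sum.
\<close>
lemma lambert_series_nth:
  fixes A :: "nat \<Rightarrow> 'k::field"
  assumes "(\<lambda>r. fps_const (A (Suc r)) * fps_X ^ Suc r / (1 - fps_X ^ Suc r)) sums f"
  shows "fps_nth f n = (if n = 0 then 0 else \<Sum>r | r dvd n. A r)"
proof -
  let ?t = "\<lambda>r. fps_const (A (Suc r)) * fps_X ^ Suc r / (1 - fps_X ^ Suc r)"
  have "\<forall>\<^sub>F M in sequentially. fps_nth (\<Sum>r<M. ?t r) n = fps_nth f n"
    using assms unfolding sums_def tendsto_fps_iff by blast
  then obtain M0 where "\<And>M. M \<ge> M0 \<Longrightarrow> fps_nth (\<Sum>r<M. ?t r) n = fps_nth f n"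
    unfolding eventually_sequentially by blast
  from this[of "max M0 n"] have "fps_nth f n = (\<Sum>r<max M0 n. fps_nth (?t r) n)"
    by (simp add: fps_sum_nth)
  also have "\<dots> = (\<Sum>r<max M0 n. if n > 0 \<and> Suc r dvd n then A (Suc r) else 0)"
    by (simp only: lambert_term_nth[OF zero_less_Suc])
  also have "\<dots> = (if n = 0 then 0 else \<Sum>r | r dvd n. A r)"
  proof (cases "n = 0")
    case False
    then have "(\<Sum>r<max M0 n. if n > 0 \<and> Suc r dvd n then A (Suc r) else 0)
      = (\<Sum>r\<in>{r. r < max M0 n \<and> Suc r dvd n}. A (Suc r))"
      by (intro sum.mono_neutral_cong_right) auto
    also have "\<dots> = (\<Sum>r | r dvd n. A r)"
    proof (rule sum.reindex_bij_betw)
      have "r \<in> Suc ` {r. r < max M0 n \<and> Suc r dvd n}" if "r dvd n" for r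
        using that False dvd_imp_le[of r n] by (cases r) auto
      then show "bij_betw Suc {r. r < max M0 n \<and> Suc r dvd n} {r. r dvd n}"
        by (auto simp: bij_betw_def)
    qed
    finally show ?thesis using False by simp
  qed simp
  finally show ?thesis .
qed

text \<open>
  In \<open>k n - k (n / p)\<close> only the \<open>A r\<close> with \<open>r\<close> dividing \<open>n\<close> and \<open>n / r\<close> prime to \<open>p\<close> survive. For
  these \<open>n / r\<close> is a unit, so division by \<open>n ^ 3\<close> and by \<open>r ^ 3\<close> are equivalent, and \<open>A n\<close> is
  obtained from the congruence and the terms with \<open>r < n\<close>.
\<close>
lemma Zp_div_cube_if_supercongruence:
  fixes A k :: "nat \<Rightarrow> 'p::prime_card padic"
  assumes k: "\<And>n. n > 0 \<Longrightarrow> k n = (\<Sum>r | r dvd n. A r)"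
    and cong: "\<And>n. n > 0 \<Longrightarrow>
      (k n - (if CARD('p) dvd n then k (n div CARD('p)) else 0)) / of_nat n ^ 3 \<in> Zp"
    and n: "n > 0"
  shows "A n / of_nat n ^ 3 \<in> Zp"
  using n
proof (induction n rule: less_induct)
  case (less n)
  let ?p = "CARD('p)"
  have p: "prime ?p" by (rule prime_card)
  define I where "I = {r. r dvd n \<and> \<not> ?p dvd n div r}"
  have fin: "finite {r. r dvd m}" if "m > 0" for m :: nat
    using that by simp
  have finI: "finite I"
    using fin[OF less.prems] by (rule rev_finite_subset) (auto simp: I_def)
  have I: "k n - (if ?p dvd n then k (n div ?p) else 0) = sum A I"
  proof (cases "?p dvd n")
    case True
    then obtain c where c: "n = ?p * c" by blast
    then have c0: "c > 0" using less.prems by (cases c) auto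
    have pn: "?p > 0" using p by (rule prime_gt_0_nat)
    have "{r. r dvd n} - I = {r. r dvd c}"
    proof (rule subset_antisym; rule subsetI)
      fix r assume "r \<in> {r. r dvd n} - I"
      then obtain d e where "n = r * d" "d = ?p * e" "r \<noteq> 0"
        using less.prems by (auto simp: I_def elim!: dvdE)
      then have "?p * c = ?p * (r * e)" using c by (simp add: mult_ac)
      then show "r \<in> {r. r dvd c}" using pn by simp
    next
      fix r assume "r \<in> {r. r dvd c}"
      then obtain d where "c = r * d" by auto
      then have "n = r * (?p * d)" "r \<noteq> 0" using c c0 by (auto simp: mult_ac)
      then show "r \<in> {r. r dvd n} - I" by (simp add: I_def)
    qed
    then have "(\<Sum>r | r dvd n. A r) - sum A I = (\<Sum>r | r dvd c. A r)"
      using sum_diff[of "{r. r dvd n}" I A] fin[OF less.prems] by (simp add: I_def subset_iff)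
    then show ?thesis
      using True c c0 pn k[OF less.prems] k[OF c0] by (simp add: algebra_simps)
  next
    case False
    then have "I = {r. r dvd n}" unfolding I_def by (metis dvd_mult dvd_mult_div_cancel)
    then show ?thesis using False k[OF less.prems] by simp
  qed
  have "n div n = 1" using less.prems by simp
  then have "n \<in> I" using p by (auto simp: I_def dest: prime_gt_1_nat)
  then have "A n = (k n - (if ?p dvd n then k (n div ?p) else 0)) - (\<Sum>r\<in>I - {n}. A r)"
    unfolding I using finI by (simp add: sum_diff1)
  then have "A n / of_nat n ^ 3 = (k n - (if ?p dvd n then k (n div ?p) else 0)) / of_nat n ^ 3
      - (\<Sum>r\<in>I - {n}. A r / of_nat n ^ 3)"
    by (simp add: diff_divide_distrib sum_divide_distrib)
  moreover have "A r / of_nat n ^ 3 \<in> Zp" if r: "r \<in> I - {n}" for r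
  proof -
    obtain d where d: "n = r * d" using r by (auto simp: I_def)
    then have pos: "r > 0" "d > 0" using less.prems by auto
    moreover have "r < n" using r d pos by (cases "d = 1") auto
    ultimately have "A r / of_nat r ^ 3 \<in> Zp" using less.IH by blast
    moreover have "coprime d ?p"
      using r d pos p by (auto simp: I_def coprime_commute[of d] intro: prime_imp_coprime)
    then have "inverse (of_nat d) ^ 3 \<in> (Zp :: 'p padic set)"
      by (intro Zp_power Zp_inverse_of_nat)
    moreover have "A r / of_nat n ^ 3 = A r / of_nat r ^ 3 * inverse (of_nat d) ^ 3"
      by (simp add: d power_mult_distrib field_simps)
    ultimately show ?thesis by (metis Zp_mult)
  qed
  ultimately show ?case
    using cong[OF less.prems] Zp_diff Zp_sum by metis
qed

lemma fps_nth_compose_X_power: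
  fixes f :: "'k::idom fps"
  assumes "m > 0"
  shows "fps_nth (f oo fps_X ^ m) n = (if m dvd n then fps_nth f (n div m) else 0)"
proof -
  have "fps_nth (f oo fps_X ^ m) n = (\<Sum>i=0..n. if n = m * i then fps_nth f i else 0)"
    by (simp add: fps_compose_nth fps_X_power_nth if_distrib flip: power_mult cong: if_cong)
  also have "\<dots> = (if m dvd n then fps_nth f (n div m) else 0)"
  proof (cases "m dvd n")
    case True
    then have "(\<Sum>i=0..n. if n = m * i then fps_nth f i else 0) = (\<Sum>i=0..n. if i = n div m then fps_nth f i else 0)"
      using assms by (intro sum.cong) auto
    then show ?thesis using True by simp
  qed (auto intro!: sum.neutral)
  finally show ?thesis .
qed

section \<open>Integrality of the instanton numbers\<close>

theorem theorem1p7: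
  fixes a F :: "nat \<Rightarrow> 'p::prime_card padic fps"
    and K :: "'p padic fps"
    and A :: "nat \<Rightarrow> 'p padic"
  assumes "odd CARD('p)"
    and "\<forall>i<4. a i \<in> Zp_fps \<and> fps_nth (a i) 0 = 0"
    and "standard_basis a F"
    and "exp_ratio F \<in> Zp_fps"
    and "[:K:] = theta_log (theta_log (y2_over_y0_in_q F))"
    and "(\<lambda>r. fps_const (A (Suc r)) * fps_X ^ Suc r / (1 - fps_X ^ Suc r)) sums (K - 1)"
    and "self_dual a"
    and "\<exists>B. frobenius_structure a (t_sigma F) B \<and> fps_nth (B 1) 0 = 0"
  shows "\<forall>r\<ge>1. A r / of_nat r ^ 3 \<in> Zp"
proof -
  let ?p = "CARD('p)"
  have p: "prime ?p" by (rule prime_card)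
  then have p1: "?p > 1" by (rule prime_gt_1_nat)
  obtain B where frob: "frobenius_structure a (t_sigma F) B" and B1: "fps_nth (B 1) 0 = 0"
    using assms(8) by blast
  have B: "B i \<in> Zp_fps" if "i < 4" for i
    using frob that by (simp add: frobenius_structure_def)
  have B0: "fps_nth (B 0) 0 = 1"
    using frob by (simp add: frobenius_structure_def)
  have lift: "t_sigma F = power_lift F ?p"
    by (simp add: t_sigma_def power_lift_def)
  have sol: "is_solution a (\<Sum>i<4. smult (B i) ((theta_log ^^ i) (log_subst (power_lift F ?p) y)))"
    if "is_solution a y" for y
    using frob that by (simp add: frobenius_structure_def lift)
  have F: "fps_nth (F 1) 0 = 0" "fps_nth (F 0) 0 = 1"
    using assms(3) by (simp_all add: standard_basis_def)
  let ?s = "power_lift F ?p"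
  define b where "b = B 3 * (F 0 oo ?s) * theta_log_coord F ^ 3 * inverse (F 0)"
  have a0: "\<forall>i<4. fps_nth (a i) 0 = 0" using assms(2) by simp
  note rel = frobenius_relation[OF a0 assms(3,7) _ sol B0 B1 assms(5), folded b_def]
  have F0: "F 0 = (\<Sum>i<4. B i * (theta ^^ i) (F 0 oo ?s))"
    and K: "2 * (K - (K oo fps_X ^ ?p)) = - theta (theta (theta ((b oo t_of_q F) * (K oo fps_X ^ ?p))))"
    using rel p1 by simp_all

  have E: "exp_ratio F \<in> Zp_fps" by (rule assms(4))
  have E0: "fps_nth (exp_ratio F) 0 = 1" by (simp add: exp_ratio_def)
  have q: "canonical_coord F \<in> Zp_fps"
    unfolding canonical_coord_def by (intro Zp_fps_mult Zp_fps_X E)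
  have t: "t_of_q F \<in> Zp_fps"
    unfolding t_of_q_def by (rule Zp_fps_inv[OF q canonical_coord_nth(2)])
  have s: "?s \<in> Zp_fps"
    unfolding power_lift_def by (intro Zp_fps_compose t Zp_fps_power q)
  \<comment> \<open>The series \<open>f = F 1 / F 0\<close> itself need not be integral, but \<open>\<theta> f = \<theta> (exp f) / exp f\<close> is.\<close>
  have g: "theta_log_coord F \<in> Zp_fps"
  proof -
    have "fps_nth (F 1 / F 0) 0 = 0" using F by (simp add: fps_divide_unit)
    then have "theta (exp_ratio F) = exp_ratio F * theta (F 1 / F 0)"
      by (simp add: exp_ratio_def theta_compose)
    then have "exp_ratio F * theta_log_coord F = exp_ratio F + theta (exp_ratio F)"
      by (simp add: theta_log_coord_def algebra_simps)
    moreover have "inverse (exp_ratio F) * exp_ratio F = 1"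
      using E0 by (simp add: inverse_mult_eq_1)
    ultimately have "theta_log_coord F = inverse (exp_ratio F) * (exp_ratio F + theta (exp_ratio F))"
      by (metis mult.assoc mult_1)
    also have "\<dots> \<in> Zp_fps"
      using E E0 by (intro Zp_fps_mult Zp_fps_add Zp_fps_theta Zp_fps_inverse)
    finally show ?thesis .
  qed
  obtain h where h: "?s = fps_X ^ ?p * h"
    using power_lift_props[OF F, of ?p] p1 by force
  have "fps_X ^ ?p = fps_X * (fps_X ^ (?p - 1) :: 'p padic fps)"
    using p1 by (simp flip: power_Suc)
  then have s2: "?s = fps_X * (fps_X ^ (?p - 1) * h)"
    by (simp add: h mult.assoc)
  \<comment> \<open>Both \<open>F 0\<close> and \<open>K\<close> are fixed by equations in which they occur only after a contracting substitution.\<close>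
  have F0_int: "F 0 \<in> Zp_fps"
  proof (rule Zp_fps_contraction)
    fix N assume N: "F 0 \<in> Zp_upto N"
    show "F 0 \<in> Zp_upto (Suc N)"
    proof (cases "N = 0")
      case True
      then show ?thesis using F by (simp add: Zp_upto_def)
    next
      case False
      then have "F 0 oo ?s \<in> Zp_upto (Suc N)"
        unfolding s2 using N s[unfolded s2] p1 by (intro Zp_upto_compose_Suc) simp_all
      moreover have "(theta ^^ i) f \<in> Zp_upto (Suc N)" if "f \<in> Zp_upto (Suc N)" for f :: "'p padic fps" and i
        using that by (induction i) (simp_all add: Zp_upto_theta)
      ultimately show ?thesis
        by (subst F0) (intro Zp_upto_sum Zp_upto_mult Zp_fps_upto[OF B]; simp)
    qed
  qed
  have b: "b oo t_of_q F \<in> Zp_fps"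
    unfolding b_def using F
    by (intro Zp_fps_compose Zp_fps_mult Zp_fps_power Zp_fps_inverse B F0_int s g t) simp_all

  define H where "H = (b oo t_of_q F) * (K oo fps_X ^ ?p)"
  \<comment> \<open>Here \<open>p\<close> must be odd.\<close>
  have half: "inverse 2 \<in> (Zp :: 'p padic set)"
    using Zp_inverse_of_nat[of 2, where 'p = 'p] assms(1) by (simp add: coprime_left_2_iff_odd)
  have K': "K = (K oo fps_X ^ ?p) - fps_const (inverse 2) * theta (theta (theta H))"
  proof -
    have "fps_const (inverse 2) * (2 * x) = (x :: 'p padic fps)" for x
      by (simp add: fps_numeral_fps_const flip: mult.assoc)
    then have "K - (K oo fps_X ^ ?p) = fps_const (inverse 2) * - theta (theta (theta H))"
      using K unfolding H_def by metis
    then show ?thesis by (simp add: algebra_simps)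
  qed
  have lam: "fps_nth (K - 1) n = (if n = 0 then 0 else \<Sum>r | r dvd n. A r)" for n
    by (rule lambert_series_nth[OF assms(6)])
  have K0: "fps_nth K 0 = 1"
    using lam[of 0] by simp
  have Xp: "fps_X ^ ?p \<in> (Zp_fps :: 'p padic fps set)"
    by (intro Zp_fps_power Zp_fps_X)
  have K_int: "K \<in> Zp_fps"
  proof (rule Zp_fps_contraction)
    fix N assume N: "K \<in> Zp_upto N"
    show "K \<in> Zp_upto (Suc N)"
    proof (cases "N = 0")
      case True
      then show ?thesis using K0 by (simp add: Zp_upto_def)
    next
      case False
      have X: "fps_X ^ ?p = fps_X * (fps_X ^ (?p - 1) :: 'p padic fps)"
        using p1 by (simp flip: power_Suc)
      have "K oo fps_X ^ ?p \<in> Zp_upto (Suc N)"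
        unfolding X using N False Xp[unfolded X] p1 by (intro Zp_upto_compose_Suc) simp_all
      then show ?thesis
        by (subst K', unfold H_def)
           (intro Zp_upto_diff Zp_upto_mult Zp_upto_theta Zp_fps_upto[OF Zp_fps_const] Zp_fps_upto[OF b] half)
    qed
  qed
  have H: "H \<in> Zp_fps"
    unfolding H_def by (intro Zp_fps_mult b Zp_fps_compose K_int Xp)
  have "A r / of_nat r ^ 3 \<in> Zp" if "r \<ge> 1" for r
  proof (rule Zp_div_cube_if_supercongruence)
    show "fps_nth K n = (\<Sum>r | r dvd n. A r)" if "n > 0" for n
      using lam[of n] that by simp
    show "(fps_nth K n - (if ?p dvd n then fps_nth K (n div ?p) else 0)) / of_nat n ^ 3 \<in> Zp"
      if n: "n > 0" for n
    proof -
      have "fps_nth K n - fps_nth (K oo fps_X ^ ?p) n = - (inverse 2 * of_nat n ^ 3 * fps_nth H n)"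
        by (subst (1) K') (simp add: power3_eq_cube mult.assoc)
      then have "(fps_nth K n - (if ?p dvd n then fps_nth K (n div ?p) else 0)) / of_nat n ^ 3
          = - (inverse 2 * fps_nth H n)"
        using n p1 by (simp add: fps_nth_compose_X_power divide_simps)
      moreover have "\<dots> \<in> Zp"
        using H by (intro Zp_uminus Zp_mult half) (simp add: Zp_fps_def)
      ultimately show ?thesis by simp
    qed
    show "r > 0" using that by simp
  qed
  then show ?thesis by blast
qed

end
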